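(* Let $(M^4,g,I,J)$ be a generalized Kähler-Ricci soliton on a real $4$-dimensional manifold, with soliton potential $f$ and canonical soliton vector fields $X_I,X_J$. Then, where defined, the symplectic $2$-forms $F_\pm=-2g(I\pm J)^{-1}$ satisfy $F_+(X_I,X_J)=F_-(X_I,X_J)=0$.
   Context: For a metric $g$ with compatible complex structure $J$ on a real $4$-manifold: $\omega_J(X,Y)=g(JX,Y)$, $d^c_J=\sqrt{-1}(\bar\partial_J-\partial_J)$, Lee form $\theta_J$ defined by $d\omega_J=\theta_J\wedge\omega_J$. A generalized Kähler structure $(g,I,J)$ is a Riemannian metric with two compatible integrable complex structures with $d^c_I\omega_I=H=-d^c_J\omega_J$, $dH=0$. It is a generalized Kähler-Ricci soliton if there is a smooth $f$ with $\mathrm{Rc}^{\nabla^+}+\nabla^+\nabla^+f=0$, $\nabla^+=\nabla+\tfrac12g^{-1}H$ (equivalently $\mathrm{Rc}-\tfrac14H^2+\nabla^2f=0$ and $d^*(e^{-f}H)=0$, where $H^2(X,Y)=\sum_{i,j}H(X,e_i,e_j)H(Y,e_i,e_j)$). The canonical soliton vector fields are $X_I=\tfrac12I(\theta_I^\sharp-\nabla f)$, $X_J=\tfrac12J(\theta_J^\sharp-\nabla f)$. $F_\pm(X,Y)=-2g((I\pm J)^{-1}X,Y)$ is defined where $I\pm J$ is invertible. *)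

theory Defs
  imports "HOL-Analysis.Analysis"
begin

section \<open>Smooth manifolds of dimension 4\<close>

text \<open>
  On an open set, a map is smooth iff all iterated partial derivatives exist and are (Frechet)
  differentiable. The notion below is only used on open sets.
\<close>

definition partial_deriv :: "4 \<Rightarrow> (real^4 \<Rightarrow> 'b::real_normed_vector) \<Rightarrow> real^4 \<Rightarrow> 'b" where
  "partial_deriv i h = (\<lambda>x. frechet_derivative h (at x) (axis i 1))"

definition smooth_map_on :: "(real^4) set \<Rightarrow> (real^4 \<Rightarrow> 'b::real_normed_vector) \<Rightarrow> bool" where
  "smooth_map_on S h \<longleftrightarrow> (\<forall>is. \<forall>x\<in>S. foldr partial_deriv is h differentiable (at x))"

text \<open>A chart is a pair of its domain and its coordinate map.\<close>

type_synonym 'a chart = "'a set \<times> ('a \<Rightarrow> real^4)"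

definition chart_image :: "'a chart \<Rightarrow> (real^4) set" where
  "chart_image c = snd c ` fst c"

definition chart_inv :: "'a chart \<Rightarrow> real^4 \<Rightarrow> 'a" where
  "chart_inv c = inv_into (fst c) (snd c)"

definition transition :: "'a chart \<Rightarrow> 'a chart \<Rightarrow> real^4 \<Rightarrow> real^4" where
  "transition c d = snd d \<circ> chart_inv c"

definition transition_dom :: "'a chart \<Rightarrow> 'a chart \<Rightarrow> (real^4) set" where
  "transition_dom c d = snd c ` (fst c \<inter> fst d)"

definition is_chart :: "'a topology \<Rightarrow> 'a chart \<Rightarrow> bool" where
  "is_chart M c \<longleftrightarrow>
     openin M (fst c) \<and> open (chart_image c) \<and>
     homeomorphic_map (subtopology M (fst c)) (top_of_set (chart_image c)) (snd c)"

definition smooth_4_manifold :: "'a topology \<Rightarrow> 'a chart set \<Rightarrow> bool" where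
  "smooth_4_manifold M A \<longleftrightarrow>
     Hausdorff_space M \<and> second_countable M \<and>
     (\<forall>c\<in>A. is_chart M c) \<and> \<Union> (fst ` A) = topspace M \<and>
     (\<forall>c\<in>A. \<forall>d\<in>A. smooth_map_on (transition_dom c d) (transition c d))"

text \<open>
  Tensor fields are given by their components in every chart of the atlas, subject to the
  classical transformation law. The component functions of a chart \<open>c\<close> are total functions on
  \<open>\<real>\<^sup>4\<close>, but only their values on \<open>chart_image c\<close> matter. Tangent vectors are column vectors and
  covectors are vectors acting through the dot product; a bilinear form \<open>G\<close> is the matrix with
  \<open>G(u, v) = u \<bullet> (G *v v)\<close>.
\<close>

definition jacobian :: "(real^4 \<Rightarrow> real^4) \<Rightarrow> real^4 \<Rightarrow> real^4^4" where
  "jacobian h x = matrix (frechet_derivative h (at x))"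

definition smooth_function :: "'a chart set \<Rightarrow> ('a \<Rightarrow> real) \<Rightarrow> bool" where
  "smooth_function A f \<longleftrightarrow> (\<forall>c\<in>A. smooth_map_on (chart_image c) (f \<circ> chart_inv c))"

definition smooth_bilinear_field :: "'a chart set \<Rightarrow> ('a chart \<Rightarrow> real^4 \<Rightarrow> real^4^4) \<Rightarrow> bool" where
  "smooth_bilinear_field A g \<longleftrightarrow>
     (\<forall>c\<in>A. smooth_map_on (chart_image c) (g c)) \<and>
     (\<forall>c\<in>A. \<forall>d\<in>A. \<forall>x\<in>transition_dom c d.
        g c x = transpose (jacobian (transition c d) x) ** g d (transition c d x)
                  ** jacobian (transition c d) x)"

definition smooth_endomorphism_field :: "'a chart set \<Rightarrow> ('a chart \<Rightarrow> real^4 \<Rightarrow> real^4^4) \<Rightarrow> bool" where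
  "smooth_endomorphism_field A J \<longleftrightarrow>
     (\<forall>c\<in>A. smooth_map_on (chart_image c) (J c)) \<and>
     (\<forall>c\<in>A. \<forall>d\<in>A. \<forall>x\<in>transition_dom c d.
        jacobian (transition c d) x ** J c x = J d (transition c d x) ** jacobian (transition c d) x)"


section \<open>Tensor calculus in a chart\<close>

definition gprod :: "real^4^4 \<Rightarrow> real^4 \<Rightarrow> real^4 \<Rightarrow> real" where
  "gprod G u v = u \<bullet> (G *v v)"

definition sharp :: "real^4^4 \<Rightarrow> (real^4 \<Rightarrow> real) \<Rightarrow> real^4" where
  "sharp G \<alpha> = matrix_inv G *v (\<chi> i. \<alpha> (axis i 1))"

definition gradient :: "(real^4 \<Rightarrow> real^4^4) \<Rightarrow> (real^4 \<Rightarrow> real) \<Rightarrow> real^4 \<Rightarrow> real^4" where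
  "gradient G h x = sharp (G x) (frechet_derivative h (at x))"

text \<open>
  A \<open>k\<close>-form at a point is a function on argument lists, of which only the lists of length \<open>k\<close>
  are relevant. The exterior derivative is the invariant formula evaluated on constant vector
  fields, whose brackets vanish; it is normalised so that \<open>d(h \<alpha>) = dh \<and> \<alpha> + h d\<alpha>\<close> for the wedge
  product below.
\<close>

type_synonym kform = "(real^4) list \<Rightarrow> real"

definition ext_deriv :: "(real^4 \<Rightarrow> kform) \<Rightarrow> real^4 \<Rightarrow> kform" where
  "ext_deriv \<alpha> x vs =
     (\<Sum>i<length vs. (-1)^i *
        frechet_derivative (\<lambda>y. \<alpha> y (take i vs @ drop (Suc i) vs)) (at x) (vs ! i))"

definition wedge1 :: "real^4 \<Rightarrow> kform \<Rightarrow> kform" where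
  "wedge1 \<theta> \<alpha> vs = (\<Sum>i<length vs. (-1)^i * (\<theta> \<bullet> (vs ! i)) * \<alpha> (take i vs @ drop (Suc i) vs))"

definition lie_bracket :: "(real^4 \<Rightarrow> real^4) \<Rightarrow> (real^4 \<Rightarrow> real^4) \<Rightarrow> real^4 \<Rightarrow> real^4" where
  "lie_bracket X Y x = frechet_derivative Y (at x) (X x) - frechet_derivative X (at x) (Y x)"

text \<open>
  Linear connections are represented by their Christoffel maps: \<open>\<nabla>\<^sub>u w = D\<^sub>u w + \<Gamma>(u, w)\<close>.
  Since curvature and Hessian are tensors, they are computed on constant vector fields.
\<close>

type_synonym connection = "real^4 \<Rightarrow> real^4 \<Rightarrow> real^4 \<Rightarrow> real^4"

definition levi_civita :: "(real^4 \<Rightarrow> real^4^4) \<Rightarrow> connection" where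
  "levi_civita G x u v = (1/2) *\<^sub>R sharp (G x) (\<lambda>w.
       frechet_derivative (\<lambda>y. gprod (G y) v w) (at x) u
     + frechet_derivative (\<lambda>y. gprod (G y) u w) (at x) v
     - frechet_derivative (\<lambda>y. gprod (G y) u v) (at x) w)"

text \<open>\<open>\<nabla>\<^sup>+ = \<nabla> + 1/2 g\<^sup>-\<^sup>1 H\<close>, i.e. \<open>g(\<nabla>\<^sup>+\<^sub>u v, w) = g(\<nabla>\<^sub>u v, w) + 1/2 H(u, v, w)\<close>.\<close>

definition bismut_plus :: "(real^4 \<Rightarrow> real^4^4) \<Rightarrow> (real^4 \<Rightarrow> kform) \<Rightarrow> connection" where
  "bismut_plus G H x u v = levi_civita G x u v + (1/2) *\<^sub>R sharp (G x) (\<lambda>w. H x [u, v, w])"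

text \<open>\<open>R(u, v) w = \<nabla>\<^sub>u \<nabla>\<^sub>v w - \<nabla>\<^sub>v \<nabla>\<^sub>u w - \<nabla>\<^sub>[\<^sub>u\<^sub>,\<^sub>v\<^sub>] w\<close>\<close>

definition curvature :: "connection \<Rightarrow> real^4 \<Rightarrow> real^4 \<Rightarrow> real^4 \<Rightarrow> real^4 \<Rightarrow> real^4" where
  "curvature \<Gamma> x u v w =
     frechet_derivative (\<lambda>y. \<Gamma> y v w) (at x) u - frechet_derivative (\<lambda>y. \<Gamma> y u w) (at x) v
     + \<Gamma> x u (\<Gamma> x v w) - \<Gamma> x v (\<Gamma> x u w)"

text \<open>
  \<open>Rc(u, v) = tr (z \<mapsto> R(z, u) v)\<close> and \<open>(\<nabla>\<nabla>h)(u, v) = u (v h) - (\<nabla>\<^sub>u v) h\<close>. The order of the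
  arguments matters because \<open>\<nabla>\<^sup>+\<close> has torsion; with this order the skew part of
  \<open>Rc\<^sup>+ + \<nabla>\<^sup>+\<nabla>\<^sup>+f\<close> is \<open>-1/2 (d\<^sup>*H + i\<^sub>\<nabla>\<^sub>f H) = -1/2 e\<^sup>f d\<^sup>*(e\<^sup>-\<^sup>f H)\<close>.
\<close>

definition ricci :: "connection \<Rightarrow> real^4 \<Rightarrow> real^4 \<Rightarrow> real^4 \<Rightarrow> real" where
  "ricci \<Gamma> x u v = (\<Sum>i\<in>UNIV. curvature \<Gamma> x (axis i 1) u v $ i)"

definition hessian :: "connection \<Rightarrow> (real^4 \<Rightarrow> real) \<Rightarrow> real^4 \<Rightarrow> real^4 \<Rightarrow> real^4 \<Rightarrow> real" where
  "hessian \<Gamma> h x u v =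
     frechet_derivative (\<lambda>y. frechet_derivative h (at y) v) (at x) u
     - frechet_derivative h (at x) (\<Gamma> x u v)"


section \<open>Complex structures\<close>

text \<open>Vanishing of the Nijenhuis tensor, computed on constant vector fields.\<close>

definition nijenhuis :: "(real^4 \<Rightarrow> real^4^4) \<Rightarrow> real^4 \<Rightarrow> real^4 \<Rightarrow> real^4 \<Rightarrow> real^4" where
  "nijenhuis J x u v =
     lie_bracket (\<lambda>y. J y *v u) (\<lambda>y. J y *v v) x
     - J x *v lie_bracket (\<lambda>y. J y *v u) (\<lambda>y. v) x
     - J x *v lie_bracket (\<lambda>y. u) (\<lambda>y. J y *v v) x
     - lie_bracket (\<lambda>y. u) (\<lambda>y. v) x"

definition riemannian_metric :: "'a chart set \<Rightarrow> ('a chart \<Rightarrow> real^4 \<Rightarrow> real^4^4) \<Rightarrow> bool" where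
  "riemannian_metric A g \<longleftrightarrow>
     smooth_bilinear_field A g \<and>
     (\<forall>c\<in>A. \<forall>x\<in>chart_image c.
        transpose (g c x) = g c x \<and> (\<forall>u. u \<noteq> 0 \<longrightarrow> gprod (g c x) u u > 0))"

definition integrable_complex_structure :: "'a chart set \<Rightarrow> ('a chart \<Rightarrow> real^4 \<Rightarrow> real^4^4) \<Rightarrow> bool" where
  "integrable_complex_structure A J \<longleftrightarrow>
     smooth_endomorphism_field A J \<and>
     (\<forall>c\<in>A. \<forall>x\<in>chart_image c.
        J c x ** J c x = - mat 1 \<and> (\<forall>u v. nijenhuis (J c) x u v = 0))"

definition compatible ::
    "'a chart set \<Rightarrow> ('a chart \<Rightarrow> real^4 \<Rightarrow> real^4^4) \<Rightarrow> ('a chart \<Rightarrow> real^4 \<Rightarrow> real^4^4) \<Rightarrow> bool" where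
  "compatible A g J \<longleftrightarrow>
     (\<forall>c\<in>A. \<forall>x\<in>chart_image c. \<forall>u v.
        gprod (g c x) (J c x *v u) (J c x *v v) = gprod (g c x) u v)"

text \<open>\<open>\<omega>\<^sub>J(u, v) = g(Ju, v)\<close>\<close>

definition fund_form :: "(real^4 \<Rightarrow> real^4^4) \<Rightarrow> (real^4 \<Rightarrow> real^4^4) \<Rightarrow> real^4 \<Rightarrow> kform" where
  "fund_form G J x vs = gprod (G x) (J x *v (vs ! 0)) (vs ! 1)"

text \<open>The complex multilinear extension of a real multilinear form.\<close>

fun complexify :: "kform \<Rightarrow> (complex^4) list \<Rightarrow> complex" where
  "complexify \<alpha> [] = complex_of_real (\<alpha> [])"
| "complexify \<alpha> (z # zs) =
     complexify (\<lambda>vs. \<alpha> ((\<chi> i. Re (z $ i)) # vs)) zs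
     + \<i> * complexify (\<lambda>vs. \<alpha> ((\<chi> i. Im (z $ i)) # vs)) zs"

text \<open>
  The components of a real vector in \<open>T\<^sup>1\<^sup>,\<^sup>0\<close> and \<open>T\<^sup>0\<^sup>,\<^sup>1\<close>, the eigenspaces of \<open>J\<close> for \<open>\<i>\<close> and
  \<open>-\<i>\<close>: \<open>(v - \<i> Jv)/2\<close> and \<open>(v + \<i> Jv)/2\<close>.
\<close>

definition proj10 :: "real^4^4 \<Rightarrow> real^4 \<Rightarrow> complex^4" where
  "proj10 J v = (\<chi> i. (complex_of_real (v $ i) - \<i> * complex_of_real ((J *v v) $ i)) / 2)"

definition proj01 :: "real^4^4 \<Rightarrow> real^4 \<Rightarrow> complex^4" where
  "proj01 J v = (\<chi> i. (complex_of_real (v $ i) + \<i> * complex_of_real ((J *v v) $ i)) / 2)"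

text \<open>The \<open>(p, k - p)\<close> part of a real \<open>k\<close>-form, evaluated on \<open>k\<close> real vectors.\<close>

definition type_part :: "nat \<Rightarrow> real^4^4 \<Rightarrow> kform \<Rightarrow> (real^4) list \<Rightarrow> complex" where
  "type_part p J \<alpha> vs =
     (\<Sum>S | S \<subseteq> {..<length vs} \<and> card S = p.
        complexify \<alpha> (map (\<lambda>i. if i \<in> S then proj10 J (vs ! i) else proj01 J (vs ! i))
                          [0..<length vs]))"

text \<open>
  On a form of type \<open>(p, q)\<close>, \<open>\<partial>\<close> and its conjugate are the \<open>(p+1, q)\<close> and \<open>(p, q+1)\<close> parts of
  \<open>d\<close>; \<open>q\<close> is determined by \<open>p\<close> and the degree. They are only applied to \<open>\<omega>\<^sub>J\<close>, which is of type
  \<open>(1, 1)\<close> by compatibility.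
\<close>

definition del :: "nat \<Rightarrow> (real^4 \<Rightarrow> real^4^4) \<Rightarrow> (real^4 \<Rightarrow> kform) \<Rightarrow> real^4 \<Rightarrow> (real^4) list \<Rightarrow> complex" where
  "del p J \<alpha> x = type_part (p + 1) (J x) (ext_deriv \<alpha> x)"

definition delbar :: "nat \<Rightarrow> (real^4 \<Rightarrow> real^4^4) \<Rightarrow> (real^4 \<Rightarrow> kform) \<Rightarrow> real^4 \<Rightarrow> (real^4) list \<Rightarrow> complex" where
  "delbar p J \<alpha> x = type_part p (J x) (ext_deriv \<alpha> x)"

definition dc_fund :: "(real^4 \<Rightarrow> real^4^4) \<Rightarrow> (real^4 \<Rightarrow> real^4^4) \<Rightarrow> real^4 \<Rightarrow> (real^4) list \<Rightarrow> complex" where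
  "dc_fund G J x vs = \<i> * (delbar 1 J (fund_form G J) x vs - del 1 J (fund_form G J) x vs)"

text \<open>
  The Lee form. In real dimension 4 the equation \<open>d\<omega>\<^sub>J = \<theta> \<and> \<omega>\<^sub>J\<close> has exactly one solution at
  every point, because \<open>\<omega>\<^sub>J\<close> is nondegenerate.
\<close>

definition lee_form :: "(real^4 \<Rightarrow> real^4^4) \<Rightarrow> (real^4 \<Rightarrow> real^4^4) \<Rightarrow> real^4 \<Rightarrow> real^4" where
  "lee_form G J x =
     (THE \<theta>. \<forall>vs. length vs = 3 \<longrightarrow>
        ext_deriv (fund_form G J) x vs = wedge1 \<theta> (fund_form G J x) vs)"


section \<open>Generalized Kahler-Ricci solitons\<close>

text \<open>The 3-form \<open>H\<close> is determined by the equations, which also give its transformation law.\<close>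

definition generalized_kahler ::
    "'a chart set \<Rightarrow> ('a chart \<Rightarrow> real^4 \<Rightarrow> real^4^4) \<Rightarrow> ('a chart \<Rightarrow> real^4 \<Rightarrow> real^4^4) \<Rightarrow>
     ('a chart \<Rightarrow> real^4 \<Rightarrow> real^4^4) \<Rightarrow> ('a chart \<Rightarrow> real^4 \<Rightarrow> kform) \<Rightarrow> bool" where
  "generalized_kahler A g I J H \<longleftrightarrow>
     riemannian_metric A g \<and>
     integrable_complex_structure A I \<and> compatible A g I \<and>
     integrable_complex_structure A J \<and> compatible A g J \<and>
     (\<forall>c\<in>A. \<forall>x\<in>chart_image c.
        (\<forall>vs. length vs = 3 \<longrightarrow>
           dc_fund (g c) (I c) x vs = complex_of_real (H c x vs) \<and>
           complex_of_real (H c x vs) = - dc_fund (g c) (J c) x vs) \<and>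
        (\<forall>vs. length vs = 4 \<longrightarrow> ext_deriv (H c) x vs = 0))"

definition soliton_potential ::
    "'a chart set \<Rightarrow> ('a chart \<Rightarrow> real^4 \<Rightarrow> real^4^4) \<Rightarrow> ('a chart \<Rightarrow> real^4 \<Rightarrow> kform) \<Rightarrow>
     ('a \<Rightarrow> real) \<Rightarrow> bool" where
  "soliton_potential A g H f \<longleftrightarrow>
     smooth_function A f \<and>
     (\<forall>c\<in>A. \<forall>x\<in>chart_image c. \<forall>u v.
        ricci (bismut_plus (g c) (H c)) x u v
        + hessian (bismut_plus (g c) (H c)) (f \<circ> chart_inv c) x u v = 0)"

text \<open>\<open>X\<^sub>J = 1/2 J (\<theta>\<^sub>J\<^sup>\<sharp> - \<nabla>f)\<close>\<close>

definition soliton_field ::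
    "(real^4 \<Rightarrow> real^4^4) \<Rightarrow> (real^4 \<Rightarrow> real^4^4) \<Rightarrow> (real^4 \<Rightarrow> real) \<Rightarrow> real^4 \<Rightarrow> real^4" where
  "soliton_field G J h x =
     (1/2) *\<^sub>R (J x *v (sharp (G x) (\<lambda>v. lee_form G J x \<bullet> v) - gradient G h x))"

text \<open>\<open>-2 g(K\<^sup>-\<^sup>1 u, v)\<close>, for \<open>K = I + J\<close> and \<open>K = I - J\<close>, where \<open>K\<close> is invertible.\<close>

definition F_form :: "real^4^4 \<Rightarrow> real^4^4 \<Rightarrow> real^4 \<Rightarrow> real^4 \<Rightarrow> real" where
  "F_form G K u v = -2 * gprod G (matrix_inv K *v u) v"

end

theory Submission
  imports Defs
begin

text \<open>
  Fix \<open>K = I\<close> or \<open>K = J\<close> and write \<open>\<theta>\<close> for its Lee form. In dimension 4 the form \<open>H\<close> is a multiple of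
  \<open>(\<theta> \<circ> K) \<and> \<omega>\<^sub>K\<close>, that is, of the Hodge dual of \<open>\<theta>\<close>, so the skew part of the soliton equation, which
  is \<open>d\<^sup>*(e\<^sup>-\<^sup>f H) = 0\<close>, says \<open>d\<theta> = df \<and> \<theta>\<close>. On the other hand \<open>0 = dd\<omega>\<^sub>K = d\<theta> \<and> \<omega>\<^sub>K\<close>. Hence
  \<open>df \<and> \<theta> \<and> \<omega>\<^sub>K = 0\<close>, which means \<open>df(K \<theta>\<^sup>\<sharp>) = 0\<close>.

  If \<open>I + J\<close> or \<open>I - J\<close> is invertible, then \<open>I\<close> and \<open>J\<close> induce the same orientation, \<open>(I \<plusminus> J)\<^sup>2\<close> is a multiple
  of the identity, and \<open>d\<^sup>c\<^sub>I\<omega>\<^sub>I = -d\<^sup>c\<^sub>J\<omega>\<^sub>J\<close> gives \<open>\<theta>\<^sub>J = -\<theta>\<^sub>I\<close>. Expanding \<open>F\<^sub>\<plusminus>(X\<^sub>I, X\<^sub>J)\<close> then leaves a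
  multiple of \<open>df((J \<plusminus> I) \<theta>\<^sub>I\<^sup>\<sharp>)\<close>.

  The orientation is encoded by the sign of the Pfaffian \<open>pf\<close> of \<open>\<omega>\<^sub>K\<close>, whose modulus is the volume density:
  with \<open>W\<close> the matrix of \<open>\<omega>\<^sub>K\<close> one has \<open>hodge W = pf W g\<^sup>-\<^sup>1 K\<^sup>T\<close>.
\<close>

section \<open>Partial derivatives\<close>

lemma partial_deriv_eqI:
  "(h has_derivative h') (at x) \<Longrightarrow> partial_deriv i h x = h' (axis i 1)"
  unfolding partial_deriv_def using frechet_derivative_at by metis

text \<open>The mean value theorem along \<open>axis i 1\<close> turns the second difference into a
  difference of first partials, which differentiability of \<open>partial_deriv i h\<close> at
  \<open>x\<close> then estimates. The quotient is symmetric in its two directions, so both orders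
  of differentiation can be read off from it.\<close>

lemma tendsto_second_difference:
  fixes h :: "real^4 \<Rightarrow> real"
  assumes "open S" "x \<in> S" and h: "\<And>y. y \<in> S \<Longrightarrow> h differentiable (at y)"
    and a: "partial_deriv i h differentiable (at x)"
  shows "((\<lambda>t. (h (x + t *\<^sub>R axis i 1 + t *\<^sub>R v) - h (x + t *\<^sub>R axis i 1) - h (x + t *\<^sub>R v) + h x) / t\<^sup>2)
           \<longlongrightarrow> frechet_derivative (partial_deriv i h) (at x) v) (at_right 0)"
proof (rule tendstoI)
  fix \<epsilon> :: real assume "\<epsilon> > 0"
  let ?u = "axis i 1 :: real^4"
  let ?a = "partial_deriv i h"
  let ?D = "frechet_derivative ?a (at x)"
  \<comment> \<open>The two linearisation errors below are at most
    \<open>e * t * (1 + norm v)\<close> and \<open>e * t\<close>; this choice makes their sum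
    \<open>\<epsilon> / 2 * t\<close>.\<close>
  define e where "e = \<epsilon> / (2 * (2 + norm v))"
  have nv: "2 + norm v > 0" using norm_ge_zero[of v] by linarith
  have e: "e > 0" using \<open>\<epsilon> > 0\<close> nv by (simp add: e_def)
  have D: "(?a has_derivative ?D) (at x)" using a frechet_derivative_works by blast
  interpret D: bounded_linear ?D using D by (rule has_derivative_bounded_linear)
  obtain d1 where d1: "d1 > 0" "\<And>y. norm (y - x) < d1 \<Longrightarrow> norm (?a y - ?a x - ?D (y - x)) \<le> e * norm (y - x)"
    using D e unfolding has_derivative_at_alt by blast
  obtain d2 where d2: "d2 > 0" "ball x d2 \<subseteq> S" using assms(1,2) open_contains_ball by blast
  \<comment> \<open>Bounds \<open>t\<close> so that all points
    \<open>x + s *\<^sub>R ?u + r *\<^sub>R v\<close> with \<open>s\<close> and \<open>r\<close>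
    between 0 and \<open>t\<close> stay within \<open>min d1 d2\<close> of \<open>x\<close>.\<close>
  define d where "d = min d1 d2 / (1 + norm v)"
  have "d > 0" using d1 d2 norm_ge_zero[of v] by (auto simp: d_def intro!: divide_pos_pos add_pos_nonneg)
  have main: "dist ((h (x + t *\<^sub>R ?u + t *\<^sub>R v) - h (x + t *\<^sub>R ?u) - h (x + t *\<^sub>R v) + h x) / t\<^sup>2) (?D v) < \<epsilon>"
    if t: "t \<in> {0<..<d}" for t
  proof -
    have small: "norm (s *\<^sub>R ?u + r *\<^sub>R v) < min d1 d2" if "0 \<le> s" "s \<le> t" "0 \<le> r" "r \<le> t" for s r
    proof -
      have "norm (s *\<^sub>R ?u + r *\<^sub>R v) \<le> s + r * norm v"
        using that by (intro norm_triangle_le) simp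
      also have "\<dots> \<le> t * (1 + norm v)"
        using that by (simp add: algebra_simps add_mono mult_right_mono)
      also have "\<dots> < min d1 d2"
        using t norm_ge_zero[of v] unfolding d_def
        by (simp add: pos_less_divide_eq add_pos_nonneg del: min_less_iff_conj)
      finally show ?thesis .
    qed
    \<comment> \<open>With the step along \<open>v\<close> frozen, the second difference is
      \<open>\<phi> t - \<phi> 0\<close>.\<close>
    define \<phi> where "\<phi> s = h (x + s *\<^sub>R ?u + t *\<^sub>R v) - h (x + s *\<^sub>R ?u)" for s
    have der: "(\<phi> has_real_derivative (?a (x + s *\<^sub>R ?u + t *\<^sub>R v) - ?a (x + s *\<^sub>R ?u))) (at s)"
      if s: "0 \<le> s" "s \<le> t" for s
    proof -
      have *: "((\<lambda>s. h (x + s *\<^sub>R ?u + r *\<^sub>R v)) has_real_derivative ?a (x + s *\<^sub>R ?u + r *\<^sub>R v)) (at s)"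
        if "0 \<le> r" "r \<le> t" for r
      proof -
        have "x + s *\<^sub>R ?u + r *\<^sub>R v \<in> S"
          using small[OF s that] d2(2)
          by (metis add.assoc add_diff_cancel_left' dist_commute dist_norm mem_ball min_less_iff_conj subsetD)
        hence hd: "(h has_derivative frechet_derivative h (at (x + s *\<^sub>R ?u + r *\<^sub>R v))) (at (x + s *\<^sub>R ?u + r *\<^sub>R v))"
          using h frechet_derivative_works by blast
        have "((\<lambda>s. x + s *\<^sub>R ?u + r *\<^sub>R v) has_derivative (\<lambda>q. q *\<^sub>R ?u)) (at s)"
          by (auto intro!: derivative_eq_intros)
        from has_derivative_compose[where g = h and f = "\<lambda>s. x + s *\<^sub>R ?u + r *\<^sub>R v", OF this hd]
        have "((\<lambda>s. h (x + s *\<^sub>R ?u + r *\<^sub>R v)) has_derivative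
            (\<lambda>q. frechet_derivative h (at (x + s *\<^sub>R ?u + r *\<^sub>R v)) (q *\<^sub>R ?u))) (at s)" .
        moreover have "(\<lambda>q. frechet_derivative h (at (x + s *\<^sub>R ?u + r *\<^sub>R v)) (q *\<^sub>R ?u))
            = (*) (?a (x + s *\<^sub>R ?u + r *\<^sub>R v))"
          by (rule ext) (simp add: linear_scale[OF has_derivative_linear[OF hd]] partial_deriv_def mult.commute)
        ultimately show ?thesis unfolding has_field_derivative_def by simp
      qed
      show ?thesis unfolding \<phi>_def using *[of t] *[of 0] t
        by (auto intro!: derivative_eq_intros)
    qed
    obtain \<xi> where \<xi>: "0 < \<xi>" "\<xi> < t"
      "\<phi> t - \<phi> 0 = (t - 0) * (?a (x + \<xi> *\<^sub>R ?u + t *\<^sub>R v) - ?a (x + \<xi> *\<^sub>R ?u))"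
      using MVT2[of 0 t \<phi> "\<lambda>s. ?a (x + s *\<^sub>R ?u + t *\<^sub>R v) - ?a (x + s *\<^sub>R ?u)"] der t by auto
    let ?p = "\<xi> *\<^sub>R ?u + t *\<^sub>R v" and ?q = "\<xi> *\<^sub>R ?u"
    have 1: "norm (?a (x + ?p) - ?a x - ?D ?p) \<le> e * norm ?p"
      using d1(2)[of "x + ?p"] small[of \<xi> t] \<xi> t by auto
    have 2: "norm (?a (x + ?q) - ?a x - ?D ?q) \<le> e * norm ?q"
      using d1(2)[of "x + ?q"] small[of \<xi> 0] \<xi> t by auto
    have np: "norm ?p \<le> t * (1 + norm v)"
      by (rule norm_triangle_le) (use \<xi> t in \<open>auto simp: algebra_simps\<close>)
    have nq: "norm ?q \<le> t" using \<xi> by simp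
    have "\<bar>?a (x + ?p) - ?a (x + ?q) - t * ?D v\<bar> \<le> e * norm ?p + e * norm ?q"
      using 1 2 by (simp add: D.add D.scale)
    also have "\<dots> \<le> e * (t * (1 + norm v)) + e * t"
      using np nq e by (intro add_mono mult_left_mono) auto
    also have "\<dots> = e * (2 + norm v) * t" by (simp add: algebra_simps)
    also have "\<dots> = \<epsilon> / 2 * t" using nv by (simp add: e_def divide_simps)
    finally have b: "\<bar>?a (x + ?p) - ?a (x + ?q) - t * ?D v\<bar> \<le> \<epsilon> / 2 * t" .
    have "h (x + t *\<^sub>R ?u + t *\<^sub>R v) - h (x + t *\<^sub>R ?u) - h (x + t *\<^sub>R v) + h x = t * (?a (x + ?p) - ?a (x + ?q))"
      using \<xi>(3) by (simp add: \<phi>_def add.assoc)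
    hence eq: "(h (x + t *\<^sub>R ?u + t *\<^sub>R v) - h (x + t *\<^sub>R ?u) - h (x + t *\<^sub>R v) + h x) / t\<^sup>2 - ?D v
       = (?a (x + ?p) - ?a (x + ?q) - t * ?D v) / t"
      using t by (simp add: power2_eq_square divide_simps)
    have "\<bar>(?a (x + ?p) - ?a (x + ?q) - t * ?D v) / t\<bar> \<le> \<epsilon> / 2" using b t by (simp add: abs_divide pos_divide_le_eq)
    thus ?thesis unfolding dist_real_def eq by (rule le_less_trans) (use \<open>\<epsilon> > 0\<close> in simp)
  qed
  show "\<forall>\<^sub>F t in at_right 0. dist ((h (x + t *\<^sub>R ?u + t *\<^sub>R v) - h (x + t *\<^sub>R ?u) - h (x + t *\<^sub>R v) + h x) / t\<^sup>2) (?D v) < \<epsilon>"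
    using eventually_at_right_less[of 0] eventually_at_right_real[OF \<open>d > 0\<close>]
    by eventually_elim (rule main)
qed

text \<open>Both mixed derivatives are limits of the same symmetric difference quotient.\<close>

lemma partial_deriv_commute:
  fixes h :: "real^4 \<Rightarrow> real"
  assumes "open S" "x \<in> S" "\<And>y. y \<in> S \<Longrightarrow> h differentiable (at y)"
    and "partial_deriv i h differentiable (at x)" "partial_deriv j h differentiable (at x)"
  shows "partial_deriv i (partial_deriv j h) x = partial_deriv j (partial_deriv i h) x"
proof -
  let ?D = "\<lambda>u v t. (h (x + t *\<^sub>R u + t *\<^sub>R v) - h (x + t *\<^sub>R u) - h (x + t *\<^sub>R v) + h x) / t\<^sup>2"
  have sym: "?D (axis j 1) (axis i 1) = ?D (axis i 1) (axis j 1)"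
    by (rule ext) (simp add: ac_simps)
  have "partial_deriv j (partial_deriv i h) x = frechet_derivative (partial_deriv i h) (at x) (axis j 1)"
    and "partial_deriv i (partial_deriv j h) x = frechet_derivative (partial_deriv j h) (at x) (axis i 1)"
    by (rule partial_deriv_def[THEN fun_cong])+
  moreover have "(?D (axis i 1) (axis j 1) \<longlongrightarrow> frechet_derivative (partial_deriv i h) (at x) (axis j 1)) (at_right 0)"
    by (rule tendsto_second_difference[OF assms(1-4)])
  moreover have "(?D (axis i 1) (axis j 1) \<longlongrightarrow> frechet_derivative (partial_deriv j h) (at x) (axis i 1)) (at_right 0)"
    by (rule tendsto_second_difference[OF assms(1-3,5), of "axis i 1", unfolded sym])
  ultimately show ?thesis
    by (simp add: tendsto_unique[OF trivial_limit_at_right_real])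
qed

text \<open>Lets identities that hold only on the open chart image be differentiated there.\<close>

lemma partial_deriv_cong:
  assumes "open S" "x \<in> S" "\<And>y. y \<in> S \<Longrightarrow> h y = k y"
  shows "partial_deriv i h x = partial_deriv i k x"
proof -
  \<comment> \<open>\<open>frechet_derivative\<close> is a choice among derivatives, so equal
    derivative predicates force equal values, whether or not a derivative exists.\<close>
  have "(h has_derivative D) (at x) \<longleftrightarrow> (k has_derivative D) (at x)" for D
    using assms has_derivative_transform_within_open[of _ _ x UNIV S] by (metis)
  thus ?thesis by (simp add: partial_deriv_def frechet_derivative_def)
qed

lemma differentiable_cong_open:
  assumes "open S" "x \<in> S" "\<And>y. y \<in> S \<Longrightarrow> h y = k y" "k differentiable (at x)"
  shows "h differentiable (at x)"
  using assms unfolding differentiable_def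
  by (metis has_derivative_transform_within_open)

section \<open>Differentiation rules and twice differentiable functions\<close>

context
  fixes h k :: "real^4 \<Rightarrow> real" and x :: "real^4"
  assumes h: "h differentiable (at x)" and k: "k differentiable (at x)"
begin

lemma partial_deriv_add: "partial_deriv i (\<lambda>y. h y + k y) x = partial_deriv i h x + partial_deriv i k x"
  using h k unfolding frechet_derivative_works
  by (intro trans[OF partial_deriv_eqI]) (auto intro!: derivative_eq_intros simp: partial_deriv_def)

lemma partial_deriv_mult:
  "partial_deriv i (\<lambda>y. h y * k y) x = partial_deriv i h x * k x + h x * partial_deriv i k x"
  using h k unfolding frechet_derivative_works
  by (intro trans[OF partial_deriv_eqI]) (auto intro!: derivative_eq_intros simp: partial_deriv_def)

end

lemma partial_deriv_const: "partial_deriv i (\<lambda>y. c) x = 0"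
  by (intro trans[OF partial_deriv_eqI]) (auto intro!: derivative_eq_intros)

lemma partial_deriv_uminus:
  fixes h :: "real^4 \<Rightarrow> real"
  assumes "h differentiable (at x)"
  shows "partial_deriv i (\<lambda>y. - h y) x = - partial_deriv i h x"
  using assms unfolding frechet_derivative_works
  by (intro trans[OF partial_deriv_eqI]) (auto intro!: derivative_eq_intros simp: partial_deriv_def)

lemma partial_deriv_cmult:
  fixes h :: "real^4 \<Rightarrow> real"
  assumes "h differentiable (at x)"
  shows "partial_deriv i (\<lambda>y. c * h y) x = c * partial_deriv i h x"
  using partial_deriv_mult[of "\<lambda>y. c" x h] assms by (simp add: partial_deriv_const)

lemma partial_deriv_inverse:
  fixes h :: "real^4 \<Rightarrow> real"
  assumes "h differentiable (at x)" "h x \<noteq> 0"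
  shows "partial_deriv i (\<lambda>y. inverse (h y)) x = - partial_deriv i h x / (h x)\<^sup>2"
  using assms unfolding frechet_derivative_works
  by (intro trans[OF partial_deriv_eqI]) (auto intro!: derivative_eq_intros simp: partial_deriv_def power2_eq_square field_simps)

lemma partial_deriv_sum:
  fixes h :: "'i \<Rightarrow> real^4 \<Rightarrow> real"
  assumes "\<And>a. a \<in> T \<Longrightarrow> h a differentiable (at x)"
  shows "partial_deriv i (\<lambda>y. \<Sum>a\<in>T. h a y) x = (\<Sum>a\<in>T. partial_deriv i (h a) x)"
  using assms unfolding frechet_derivative_works
  by (intro trans[OF partial_deriv_eqI]) (auto intro!: derivative_eq_intros simp: partial_deriv_def)

text \<open>This is the regularity that the argument consumes: curvature and
  \<open>dd\<omega>\<close> contain second partials of the metric and of \<omega>, and symmetry of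
  second partials asks for differentiable first partials.\<close>

definition twice_differentiable_on :: "(real^4) set \<Rightarrow> (real^4 \<Rightarrow> real) \<Rightarrow> bool" where
  "twice_differentiable_on S h \<longleftrightarrow>
     (\<forall>y\<in>S. h differentiable (at y) \<and> (\<forall>i. partial_deriv i h differentiable (at y)))"

lemma twice_differentiable_onD:
  assumes "twice_differentiable_on S h" "y \<in> S"
  shows "h differentiable (at y)" "partial_deriv i h differentiable (at y)"
  using assms by (auto simp: twice_differentiable_on_def)

lemma twice_differentiable_on_commute:
  "open S \<Longrightarrow> twice_differentiable_on S h \<Longrightarrow> x \<in> S \<Longrightarrow>
    partial_deriv i (partial_deriv j h) x = partial_deriv j (partial_deriv i h) x"
  by (rule partial_deriv_commute) (auto simp: twice_differentiable_on_def)

lemma twice_differentiable_on_add: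
  assumes "open S" "twice_differentiable_on S h" "twice_differentiable_on S k"
  shows "twice_differentiable_on S (\<lambda>y. h y + k y)"
  unfolding twice_differentiable_on_def
proof (intro ballI conjI allI)
  fix y i assume y: "y \<in> S"
  show "(\<lambda>y. h y + k y) differentiable at y"
    using assms y by (auto simp: twice_differentiable_on_def)
  show "partial_deriv i (\<lambda>y. h y + k y) differentiable at y"
    by (rule differentiable_cong_open[OF assms(1) y, where k = "\<lambda>y. partial_deriv i h y + partial_deriv i k y"])
      (use assms y in \<open>auto simp: twice_differentiable_on_def partial_deriv_add\<close>)
qed

lemma twice_differentiable_on_mult:
  assumes "open S" "twice_differentiable_on S h" "twice_differentiable_on S k"
  shows "twice_differentiable_on S (\<lambda>y. h y * k y)"
  unfolding twice_differentiable_on_def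
proof (intro ballI conjI allI)
  fix y i assume y: "y \<in> S"
  show "(\<lambda>y. h y * k y) differentiable at y"
    using assms y by (auto simp: twice_differentiable_on_def)
  show "partial_deriv i (\<lambda>y. h y * k y) differentiable at y"
    by (rule differentiable_cong_open[OF assms(1) y, where
          k = "\<lambda>y. partial_deriv i h y * k y + h y * partial_deriv i k y"])
      (use assms y in \<open>auto simp: twice_differentiable_on_def partial_deriv_mult\<close>)
qed

lemma twice_differentiable_on_const: "twice_differentiable_on S (\<lambda>y. c)"
  unfolding twice_differentiable_on_def
  by (auto simp: partial_deriv_const[abs_def])

lemma twice_differentiable_on_sum:
  assumes "open S" "\<And>a. a \<in> T \<Longrightarrow> twice_differentiable_on S (h a)"
  shows "twice_differentiable_on S (\<lambda>y. \<Sum>a\<in>T. h a y)"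
  using assms(2)
  by (induction T rule: infinite_finite_induct)
    (auto intro: twice_differentiable_on_add[OF assms(1)] twice_differentiable_on_const)

lemma frechet_derivative_nth:
  fixes h :: "real^4 \<Rightarrow> 'b::real_normed_vector^'n"
  assumes "h differentiable (at x)"
  shows "frechet_derivative (\<lambda>y. h y $ a) (at x) u = frechet_derivative h (at x) u $ a"
  using frechet_derivative_at[OF has_derivative_compose[OF assms[unfolded frechet_derivative_works]
    bounded_linear_imp_has_derivative[OF bounded_linear_vec_nth, of a]]] by metis

lemma smooth_map_onD:
  assumes "smooth_map_on S h" "y \<in> S"
  shows "h differentiable (at y)" "partial_deriv i h differentiable (at y)"
  using assms(1)[unfolded smooth_map_on_def, rule_format, OF assms(2), of "[]"]
    assms(1)[unfolded smooth_map_on_def, rule_format, OF assms(2), of "[i]"] by auto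

text \<open>Taking an entry is bounded linear, hence commutes with
  \<open>partial_deriv\<close>.\<close>

lemma smooth_map_on_entry:
  fixes G :: "real^4 \<Rightarrow> real^4^4"
  assumes "open S" "smooth_map_on S G"
  shows "twice_differentiable_on S (\<lambda>y. G y $ a $ b)"
proof -
  have G: "G differentiable (at y)" "partial_deriv i G differentiable (at y)" if "y \<in> S" for y i
    using smooth_map_onD[OF assms(2) that] by auto
  have nth: "(\<lambda>y. K y $ a $ b) differentiable (at y)" if "K differentiable (at y)" for K :: "real^4 \<Rightarrow> real^4^4" and y
    using that unfolding differentiable_def
    by (blast intro: bounded_linear.has_derivative[OF bounded_linear_vec_nth] bounded_linear.has_derivative[OF bounded_linear_vec_nth[of b] bounded_linear.has_derivative[OF bounded_linear_vec_nth[of a]]])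
  have nth1: "(\<lambda>y. K y $ a) differentiable (at y)" if "K differentiable (at y)" for K :: "real^4 \<Rightarrow> real^4^4" and y
    using that unfolding differentiable_def
    by (blast intro: bounded_linear.has_derivative[OF bounded_linear_vec_nth])
  have "partial_deriv i (\<lambda>y. G y $ a $ b) y = partial_deriv i G y $ a $ b" if "y \<in> S" for y i
    using G[OF that] by (simp add: partial_deriv_def frechet_derivative_nth nth1)
  thus ?thesis unfolding twice_differentiable_on_def
    using G nth by (auto intro: differentiable_cong_open[OF assms(1), where k = "\<lambda>y. partial_deriv _ G y $ a $ b"])
qed

lemma smooth_map_on_real: "smooth_map_on S h \<Longrightarrow> twice_differentiable_on S h"
  unfolding twice_differentiable_on_def
  using smooth_map_onD by blast

lemma twice_differentiable_on_uminus:
  assumes "open S" "twice_differentiable_on S h"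
  shows "twice_differentiable_on S (\<lambda>y. - h y)"
  using twice_differentiable_on_mult[OF assms(1) twice_differentiable_on_const[of S "-1"] assms(2)] by simp

lemma differentiable_vec:
  fixes F :: "real^4 \<Rightarrow> real^'n"
  assumes "\<And>k. (\<lambda>y. F y $ k) differentiable (at x)"
  shows "F differentiable (at x)"
proof (rule differentiable_cong_open[OF open_UNIV UNIV_I])
  show "F y = (\<Sum>k\<in>UNIV. F y $ k *\<^sub>R axis k 1)" for y
    using basis_expansion[of "F y"] by (simp add: scalar_mult_eq_scaleR)
  show "(\<lambda>y. \<Sum>k\<in>UNIV. F y $ k *\<^sub>R axis k 1) differentiable (at x)"
    using assms by (intro differentiable_sum ballI differentiable_scaleR) auto
qed

lemma frechet_derivative_expand:
  fixes h :: "real^4 \<Rightarrow> real"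
  assumes "h differentiable (at x)"
  shows "frechet_derivative h (at x) u = (\<Sum>a\<in>UNIV. u$a * partial_deriv a h x)"
proof -
  have lin: "linear (frechet_derivative h (at x))"
    using assms frechet_derivative_works has_derivative_linear by blast
  have "frechet_derivative h (at x) u = frechet_derivative h (at x) (\<Sum>a\<in>UNIV. u$a *\<^sub>R axis a 1)"
    using basis_expansion[of u] by (simp add: scalar_mult_eq_scaleR)
  also have "\<dots> = (\<Sum>a\<in>UNIV. u$a * partial_deriv a h x)"
    by (simp add: linear_sum[OF lin] linear_scale[OF lin] partial_deriv_def)
  finally show ?thesis .
qed

section \<open>Almost Hermitian linear algebra in dimension 4\<close>

lemma matrix_uminus_left: "(- A) ** B = - (A ** (B :: real^'n^'m))"
  by (simp add: matrix_matrix_mult_def vec_eq_iff sum_negf)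

lemma matrix_uminus_right: "A ** (- B) = - (A ** (B :: real^'n^'m))"
  by (simp add: matrix_matrix_mult_def vec_eq_iff sum_negf)

lemma matrix_diff_ldistrib: "A ** (B - C) = A ** B - A ** (C :: real^'n^'m)"
  by (simp add: matrix_matrix_mult_def vec_eq_iff sum_subtractf algebra_simps)

lemma matrix_scaleR_left: "(k *\<^sub>R A) ** B = k *\<^sub>R (A ** (B :: real^'n^'m))"
  by (simp add: matrix_matrix_mult_def vec_eq_iff sum_distrib_left mult.assoc)

lemma matrix_scaleR_right: "A ** (k *\<^sub>R B) = k *\<^sub>R (A ** (B :: real^'n^'m))"
  by (simp add: matrix_matrix_mult_def vec_eq_iff sum_distrib_left mult.left_commute)

lemma matrix_add_rdistrib: "(B + C) ** A = B ** A + C ** (A :: real^'n^'m)"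
  by (simp add: matrix_matrix_mult_def vec_eq_iff sum.distrib algebra_simps)

lemma transpose_uminus: "transpose (- A) = - transpose (A :: real^'n^'m)"
  by (simp add: transpose_def vec_eq_iff)

lemma matrix_vector_uminus: "A *v (- u) = - (A *v (u :: real^'n))" "(- A) *v u = - (A *v u)"
  by (simp_all add: matrix_vector_mult_def vec_eq_iff sum_negf)

text \<open>\<open>matrix_inv\<close> chooses some two-sided inverse; a right inverse of a square
  matrix is two-sided, and a two-sided inverse is unique.\<close>

lemma matrix_inv_eqI:
  fixes A B :: "real^'n^'n"
  assumes "A ** B = mat 1"
  shows "matrix_inv A = B"
proof -
  have BA: "B ** A = mat 1" using assms matrix_left_right_inverse by blast
  hence "invertible A" using assms invertible_def by blast
  hence "matrix_inv A ** A = mat 1" by (simp add: invertible_def matrix_inv_def someI_ex[of "\<lambda>A'. A ** A' = mat 1 \<and> A' ** A = mat 1"])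
  thus ?thesis by (metis assms matrix_mul_assoc matrix_mul_lid matrix_mul_rid)
qed

section \<open>Duality for skew matrices and 3-forms in four dimensions\<close>

text \<open>For a skew matrix \<open>W\<close> the entries are \<open>1/2 \<epsilon>\<^sup>i\<^sup>j\<^sup>k\<^sup>l W\<^sub>k\<^sub>l\<close>.\<close>

definition hodge :: "real^4^4 \<Rightarrow> real^4^4" where
  "hodge W = (\<chi> i j.
     if i = 1 then (if j = 2 then W$3$4 else if j = 3 then W$4$2 else if j = 4 then W$2$3 else 0)
     else if i = 2 then (if j = 1 then - W$3$4 else if j = 3 then W$1$4 else if j = 4 then W$3$1 else 0)
     else if i = 3 then (if j = 1 then - W$4$2 else if j = 2 then - W$1$4 else if j = 4 then W$1$2 else 0)
     else (if j = 1 then - W$2$3 else if j = 2 then - W$3$1 else if j = 3 then - W$1$2 else 0))"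

text \<open>The Pfaffian; writing \<open>W$4$2\<close> in place of \<open>W$2$4\<close> absorbs its
  minus sign.\<close>

definition pf :: "real^4^4 \<Rightarrow> real" where
  "pf W = W$1$2 * W$3$4 + W$1$3 * W$4$2 + W$1$4 * W$2$3"

lemma hodge_entry_skew: "hodge W $ j $ i = - hodge W $ i $ j"
proof -
  have "\<forall>i j. hodge W $ j $ i = - hodge W $ i $ j" by (simp add: hodge_def forall_4)
  thus ?thesis by blast
qed

lemma transpose_hodge: "transpose (hodge W) = - hodge W"
  unfolding vec_eq_iff transpose_def by (auto intro: hodge_entry_skew)

lemma hodge_add: "hodge (V + W) = hodge V + hodge W"
  by (simp add: hodge_def vec_eq_iff forall_4)

lemma hodge_uminus: "hodge (- W) = - hodge W"
  by (simp add: hodge_def vec_eq_iff forall_4)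

lemma skew_entry: "transpose W = - (W :: real^'n^'n) \<Longrightarrow> W $ j $ i = - W $ i $ j"
  by (drule arg_cong[where f = "\<lambda>A. A $ i $ j"]) (simp add: transpose_def)

lemma skew_entries:
  fixes W :: "real^4^4"
  assumes "transpose W = - W"
  shows "W$i$i = 0" "W$2$1 = - W$1$2" "W$3$1 = - W$1$3" "W$4$1 = - W$1$4"
    "W$3$2 = - W$2$3" "W$4$2 = - W$2$4" "W$4$3 = - W$3$4"
  using skew_entry[OF assms, of i i] by (auto intro: skew_entry[OF assms])

lemma hodge_eq_0:
  assumes "transpose W = - W" "hodge W = 0" shows "W = 0"
proof -
  show ?thesis using assms(2) by (simp add: hodge_def vec_eq_iff forall_4 skew_entries[OF assms(1)])
qed

text \<open>The Pfaffian counterpart of Cramer's rule: up to sign, \<open>hodge W\<close> plays the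
  role of the adjugate, so a skew matrix with nonzero Pfaffian has an explicit inverse.\<close>

lemma hodge_mult:
  assumes "transpose W = - W" shows "W ** hodge W = - pf W *\<^sub>R mat 1"
  by (simp add: vec_eq_iff forall_4 matrix_matrix_mult_def sum_4 hodge_def mat_def pf_def
      skew_entries[OF assms] algebra_simps)

lemma mult_hodge:
  assumes "transpose W = - W" shows "hodge W ** W = - pf W *\<^sub>R mat 1"
proof -
  have "transpose (W ** hodge W) = hodge W ** W"
    by (simp add: matrix_transpose_mul assms transpose_hodge matrix_uminus_left matrix_uminus_right)
  thus ?thesis by (simp add: hodge_mult[OF assms] transpose_scalar transpose_uminus)
qed

text \<open>For skew \<open>W\<close> these are the components of \<eta> \<and> W. The definition
  serves for forms and, later, for the contravariant \<open>Q\<close>.\<close>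

definition wedge12 :: "real^4 \<Rightarrow> real^4^4 \<Rightarrow> 4 \<Rightarrow> 4 \<Rightarrow> 4 \<Rightarrow> real" where
  "wedge12 \<eta> W a b c = \<eta>$a * W$b$c + \<eta>$b * W$c$a + \<eta>$c * W$a$b"

text \<open>Contraction with the permutation symbol, which identifies 3-forms in four variables with
  vectors.\<close>

definition dual3 :: "(4 \<Rightarrow> 4 \<Rightarrow> 4 \<Rightarrow> real) \<Rightarrow> real^4" where
  "dual3 t = (\<chi> l. if l = 1 then t 2 3 4 else if l = 2 then - t 1 3 4 else if l = 3 then t 1 2 4 else - t 1 2 3)"

lemma dual3_wedge12:
  assumes "transpose W = - W" shows "dual3 (wedge12 \<eta> W) = hodge W *v \<eta>"
  by (simp add: vec_eq_iff forall_4 matrix_vector_mult_def sum_4 hodge_def dual3_def wedge12_def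
      skew_entries[OF assms] algebra_simps)

text \<open>Adjacent transpositions generate all permutations of the three indices, so the four
  components listed in \<open>dual3\<close> determine a totally skew tensor.\<close>

lemma dual3_inj:
  assumes t: "\<And>a b c. t b a c = - t a b c" "\<And>a b c. t a c b = - t a b (c :: 4)"
    and s: "\<And>a b c. s b a c = - s a b c" "\<And>a b c. s a c b = - s a b (c :: 4)"
    and "dual3 t = dual3 s"
  shows "t a b c = s a b c"
proof -
  have e: "t 2 3 4 = s 2 3 4" "t 1 3 4 = s 1 3 4" "t 1 2 4 = s 1 2 4" "t 1 2 3 = s 1 2 3"
    using assms(5) by (simp_all add: dual3_def vec_eq_iff forall_4)
  have "t a a c = 0" "t a c c = 0" "s a a c = 0" "s a c c = 0" for a c
    using t(1)[of a a c] t(2)[of a c c] s(1)[of a a c] s(2)[of a c c] by simp_all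
  moreover from this have "t a c a = 0" "s a c a = 0" for a c
    using t(2)[of a a c] s(2)[of a a c] by simp_all
  ultimately have 0: "t a a c = 0" "t a c c = 0" "t a c a = 0" "s a a c = 0" "s a c c = 0" "s a c a = 0" for a c
    by blast+
  have perm: "t b a c = s b a c" "t a c b = s a c b" "t b c a = s b c a" "t c a b = s c a b" "t c b a = s c b a"
    if "t a b c = s a b c" for a b c
  proof -
    show 1: "t b a c = s b a c" and 2: "t a c b = s a c b"
      using that t(1)[of a b c] s(1)[of a b c] t(2)[of a b c] s(2)[of a b c] by simp_all
    show "t b c a = s b c a" and 3: "t c a b = s c a b"
      using 1 2 t(2)[of b a c] s(2)[of b a c] t(1)[of a c b] s(1)[of a c b] by simp_all
    show "t c b a = s c b a" using 3 t(2)[of c a b] s(2)[of c a b] by simp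
  qed
  have "\<forall>a b c. t a b c = s a b c"
    by (simp only: forall_4 0 e perm[OF e(1)] perm[OF e(2)] perm[OF e(3)] perm[OF e(4)])
  thus ?thesis by blast
qed

section \<open>A metric and a compatible complex structure on one tangent space\<close>

locale hermitian4 =
  fixes G K :: "real^4^4"
  assumes sym: "transpose G = G"
    and pos: "u \<noteq> 0 \<Longrightarrow> gprod G u u > 0"
    and cplx: "K ** K = - mat 1"
    and compat: "gprod G (K *v u) (K *v v) = gprod G u v"
begin

text \<open>The transposed factor comes from \<open>K\<close> sitting in the first argument of
  \<omega>: \<open>u \<bullet> (W *v v) = g(K u, v)\<close>.\<close>

definition W :: "real^4^4" where "W = transpose K ** G"

abbreviation "S \<equiv> hodge W"
abbreviation "\<rho> \<equiv> pf W"

lemma compat_matrix: "transpose K ** G ** K = G"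
proof -
  have "(transpose K ** G ** K) $ i $ j = G $ i $ j" for i j
  proof -
    have "axis i 1 \<bullet> (transpose K ** G ** K *v axis j 1) = axis i 1 \<bullet> (G *v axis j 1)"
      using compat[of "axis i 1" "axis j 1"]
      by (simp add: gprod_def matrix_vector_mul_assoc[symmetric] dot_lmul_matrix[symmetric] flip: transpose_matrix_vector)
    thus ?thesis by (simp add: inner_axis' matrix_vector_mult_basis column_def)
  qed
  thus ?thesis by (simp add: vec_eq_iff)
qed

lemma KT: "transpose K ** G = - (G ** K)" "transpose K ** transpose K = - mat 1"
proof -
  have "transpose K ** G ** K ** K = G ** K" by (simp add: compat_matrix)
  thus "transpose K ** G = - (G ** K)"
    by (simp add: matrix_mul_assoc[symmetric] cplx matrix_uminus_right) (metis minus_minus)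
  show "transpose K ** transpose K = - mat 1"
    by (metis cplx matrix_transpose_mul transpose_mat transpose_uminus)
qed

lemma skew: "transpose W = - W"
  by (metis W_def KT(1) matrix_transpose_mul sym transpose_transpose minus_minus)

lemma invertible_G: "invertible G"
proof -
  have "G *v u = 0 \<Longrightarrow> u = 0" for u using pos[of u] by (auto simp: gprod_def)
  thus ?thesis using invertible_left_inverse matrix_left_invertible_ker by blast
qed

text \<open>Left multiplication of \<open>W ** S = - \<rho> *\<^sub>R mat 1\<close> by
  \<open>transpose K\<close> cancels the factor \<open>transpose K\<close> of \<open>W\<close>. This
  ties the dual of \<omega> back to \<open>K\<close> before \<open>\<rho> \<noteq> 0\<close> is
  known.\<close>

lemma GS: "G ** S = \<rho> *\<^sub>R transpose K"
proof -
  have "(transpose K ** transpose K) ** (G ** S) = transpose K ** (W ** S)"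
    by (simp add: W_def matrix_mul_assoc)
  also have "\<dots> = - (\<rho> *\<^sub>R transpose K)"
    by (simp add: hodge_mult[OF skew] matrix_scaleR_right matrix_uminus_right)
  finally show ?thesis by (simp add: KT matrix_uminus_left)
qed

lemma SG: "S ** G = - \<rho> *\<^sub>R K"
proof -
  have "transpose (G ** S) = - (S ** G)"
    by (simp add: matrix_transpose_mul sym transpose_hodge matrix_uminus_left)
  hence "\<rho> *\<^sub>R K = - (S ** G)" by (simp add: GS transpose_scalar)
  thus ?thesis by simp
qed

text \<open>If \<rho> vanished, \<open>GS\<close> would give \<open>S = 0\<close>, hence
  \<open>W = 0\<close> and then \<open>G = 0\<close>, against positivity.\<close>

lemma pf_nonzero: "\<rho> \<noteq> 0"
proof
  assume "\<rho> = 0"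
  hence GS0: "G ** S = 0" by (simp add: GS)
  obtain B where "B ** G = mat 1" using invertible_G invertible_def by blast
  hence "S = B ** (G ** S)" by (simp add: matrix_mul_assoc)
  \<comment> \<open>The instance with scalar zero says \<open>B ** 0 = 0\<close>.\<close>
  hence "S = 0" using matrix_scaleR_right[of B 0 0] by (simp add: GS0)
  hence "W = 0" using hodge_eq_0 skew by blast
  hence "transpose K ** W = 0" using matrix_scaleR_right[of "transpose K" 0 0] by simp
  hence "G = 0" by (simp add: W_def matrix_mul_assoc KT(2) matrix_uminus_left)
  thus False using pos[of "axis 1 1"] by (simp add: gprod_def)
qed

text \<open>A consequence of \<open>GS\<close> and \<open>K ** K = - mat 1\<close>. Apart from the
  factor \<open>1 / \<rho>\<close> the inverse metric is polynomial in the entries of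
  \<open>G\<close> and \<open>K\<close>, which later gives its differentiability.\<close>

lemma matrix_inv_G: "matrix_inv G = - (1 / \<rho>) *\<^sub>R (S ** transpose K)"
  by (rule matrix_inv_eqI)
    (simp add: matrix_scaleR_right matrix_uminus_right matrix_mul_assoc GS matrix_scaleR_left KT pf_nonzero)

lemma matrix_inv_G_mult: "G ** matrix_inv G = mat 1" "matrix_inv G ** G = mat 1"
proof -
  show "G ** matrix_inv G = mat 1"
    by (simp add: matrix_inv_G matrix_scaleR_right matrix_uminus_right matrix_mul_assoc GS matrix_scaleR_left KT pf_nonzero)
  thus "matrix_inv G ** G = mat 1" using matrix_left_right_inverse by blast
qed

lemma S_eq: "S = \<rho> *\<^sub>R (matrix_inv G ** transpose K)"
proof -
  have "matrix_inv G ** (G ** S) = \<rho> *\<^sub>R (matrix_inv G ** transpose K)"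
    by (simp add: GS matrix_scaleR_right)
  thus ?thesis by (simp add: matrix_mul_assoc matrix_inv_G_mult)
qed

text \<open>These identities say that \<omega> has type \<open>(1,1)\<close>; they are what the type
  decomposition of \<open>d\<omega>\<close> uses.\<close>

lemma W_compat: "(K *v u) \<bullet> (W *v (K *v v)) = u \<bullet> (W *v v)" "(K *v u) \<bullet> (W *v v) = - (u \<bullet> (W *v (K *v v)))"
proof -
  have 1: "transpose K ** W ** K = W" "transpose K ** W = - (W ** K)"
    by (simp_all add: W_def matrix_mul_assoc KT matrix_uminus_left matrix_uminus_right)
      (simp_all add: KT(1) matrix_mul_assoc[symmetric] cplx matrix_uminus_left matrix_uminus_right)
  have 2: "(K *v u) \<bullet> z = u \<bullet> (transpose K *v z)" for z
    by (metis dot_lmul_matrix transpose_matrix_vector transpose_transpose)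
  show "(K *v u) \<bullet> (W *v (K *v v)) = u \<bullet> (W *v v)"
    unfolding 2 using 1(1) by (simp add: matrix_vector_mul_assoc matrix_mul_assoc)
  show "(K *v u) \<bullet> (W *v v) = - (u \<bullet> (W *v (K *v v)))"
    unfolding 2 by (simp add: matrix_vector_mul_assoc 1 matrix_vector_uminus)
qed

text \<open>Reads \<open>S *v \<theta>\<close> as a multiple of
  \<open>K \<theta>\<^sup>\<sharp>\<close>, so a covector \<open>df\<close> annihilates it exactly
  when \<open>df(K \<theta>\<^sup>\<sharp>) = 0\<close>.\<close>

lemma S_vec: "S *v \<theta> = - \<rho> *\<^sub>R (K *v (matrix_inv G *v \<theta>))"
proof -
  have "S = (S ** G) ** matrix_inv G"
    by (simp add: matrix_mul_assoc[symmetric] matrix_inv_G_mult)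
  also have "\<dots> = - \<rho> *\<^sub>R (K ** matrix_inv G)"
    by (simp add: SG matrix_uminus_left matrix_scaleR_left)
  finally show ?thesis by (metis matrix_vector_mul_assoc scaleR_matrix_vector_assoc)
qed

text \<open>By \<open>dual3_wedge12\<close> the left side is dual to
  \<open>(\<theta> \<circ> K) \<and> \<omega>\<close>. Comparing these 3-forms for two complex
  structures therefore compares their Lee vectors.\<close>

lemma S_KT_vec: "S *v (transpose K *v \<theta>) = - \<rho> *\<^sub>R (matrix_inv G *v \<theta>)"
proof -
  have "S ** transpose K = - \<rho> *\<^sub>R matrix_inv G"
    by (subst S_eq) (simp add: matrix_scaleR_left matrix_mul_assoc[symmetric] KT matrix_uminus_right)
  thus ?thesis by (simp only: matrix_vector_mul_assoc scaleR_matrix_vector_assoc)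
qed

lemma gprod_commute: "gprod G u v = gprod G v u"
  unfolding gprod_def by (metis dot_lmul_matrix inner_commute sym transpose_matrix_vector)

lemma gprod_skew: "gprod G (K *v u) v = - gprod G u (K *v v)"
proof -
  have "K *v (K *v u) = - u" by (simp add: matrix_vector_mul_assoc cplx matrix_vector_uminus)
  thus ?thesis using compat[of "K *v u" v] by (simp add: gprod_def)
qed

end

section \<open>Two complex structures compatible with one metric\<close>

lemma hermitian4_uminus:
  assumes "hermitian4 G K" shows "hermitian4 G (- K)"
proof -
  interpret hermitian4 G K by fact
  have "(- K) *v u = - (K *v u)" for u by (simp add: matrix_vector_uminus)
  thus ?thesis
    by unfold_locales (auto simp: sym pos cplx compat matrix_uminus_left matrix_uminus_right gprod_def
        compat[unfolded gprod_def] pos[unfolded gprod_def] matrix_vector_uminus)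
qed

text \<open>Since \<open>hodge\<close> is additive, \<open>mult_hodge\<close> for
  \<open>\<omega>\<^sub>I + \<omega>\<^sub>J\<close> says that
  \<open>?r *\<^sub>R I + ?s *\<^sub>R J\<close> times \<open>I + J\<close> is scalar, with
  \<open>?r\<close> and \<open>?s\<close> the two Pfaffians. For equal Pfaffians this is the claim;
  distinct ones would force \<open>I\<close> and \<open>J\<close> to commute, which contradicts
  invertibility.\<close>

lemma hermitian4_pair:
  assumes I: "hermitian4 G I" and J: "hermitian4 G J" and inv: "invertible (I + J)"
  obtains k where "(I + J) ** (I + J) = k *\<^sub>R mat 1" "pf (hermitian4.W G I) = pf (hermitian4.W G J)"
proof -
  interpret I: hermitian4 G I by fact
  interpret J: hermitian4 G J by fact
  let ?r = I.\<rho> and ?s = J.\<rho>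
  define c where "c = - pf (I.W + J.W)"
  have "transpose (I.W + J.W) = transpose I.W + transpose J.W" by (simp add: transpose_def vec_eq_iff)
  hence "transpose (I.W + J.W) = - (I.W + J.W)" by (simp add: I.skew J.skew)
  hence "hodge (I.W + J.W) ** (I.W + J.W) = c *\<^sub>R mat 1"
    by (simp add: mult_hodge c_def)
  also have WG: "I.W + J.W = - (G ** (I + J))"
    by (simp add: I.W_def J.W_def I.KT J.KT matrix_add_ldistrib)
  also have "hodge (- (G ** (I + J))) ** - (G ** (I + J)) = - ((hodge (I.W + J.W) ** G) ** (I + J))"
    by (simp add: WG matrix_uminus_right matrix_mul_assoc)
  also have "hodge (I.W + J.W) ** G = - (?r *\<^sub>R I + ?s *\<^sub>R J)"
    by (simp add: hodge_add matrix_add_rdistrib I.SG J.SG)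
  finally have c: "(?r *\<^sub>R I + ?s *\<^sub>R J) ** (I + J) = c *\<^sub>R mat 1"
    by (simp only: matrix_uminus_left minus_minus)
  define d where "d = c + ?r + ?s"
  have d: "?r *\<^sub>R (I ** J) + ?s *\<^sub>R (J ** I) = d *\<^sub>R mat 1"
  proof -
    have "(?r *\<^sub>R I + ?s *\<^sub>R J) ** (I + J) =
        ?r *\<^sub>R (I ** J) + ?s *\<^sub>R (J ** I) - (?r + ?s) *\<^sub>R mat 1"
      by (simp add: matrix_add_rdistrib matrix_add_ldistrib matrix_scaleR_left I.cplx J.cplx scaleR_add_left)
    thus ?thesis unfolding c d_def by (simp add: scaleR_add_left diff_eq_eq[symmetric])
  qed
  have eq: "?r = ?s"
  proof (rule ccontr)
    assume ne: "?r \<noteq> ?s"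
    \<comment> \<open>Multiplying relation \<open>d\<close> by \<open>I\<close> on the left and on
      the right and subtracting isolates \<open>J + I ** J ** I\<close>.\<close>
    have 1: "- ?r *\<^sub>R J + ?s *\<^sub>R (I ** J ** I) = d *\<^sub>R I"
      using arg_cong[OF d, of "\<lambda>A. I ** A"]
      by (simp add: matrix_add_ldistrib matrix_scaleR_right matrix_mul_assoc I.cplx matrix_uminus_left)
    have 2: "?r *\<^sub>R (I ** J ** I) + - ?s *\<^sub>R J = d *\<^sub>R I"
      using arg_cong[OF d, of "\<lambda>A. A ** I"]
      by (simp add: matrix_add_rdistrib matrix_scaleR_left matrix_mul_assoc[symmetric] I.cplx matrix_uminus_right)
    have "(?s - ?r) *\<^sub>R (J + I ** J ** I) = 0"
      using 1 2 by (simp add: algebra_simps)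
    hence "I ** J ** I = - J" using ne by (simp add: eq_neg_iff_add_eq_0 add.commute)
    hence "I ** (I ** J ** I) = - (I ** J)" by (simp add: matrix_uminus_right)
    moreover have "I ** (I ** J ** I) = - (J ** I)"
      by (simp add: matrix_mul_assoc I.cplx matrix_uminus_left)
    ultimately have "J ** I = I ** J" by simp
    \<comment> \<open>For commuting factors the product is \<open>I ** I - J ** J\<close>.
      Cancelling \<open>I + J\<close> leaves \<open>I = J\<close>, and then the Pfaffians
      agree.\<close>
    hence 0: "(I + J) ** (I - J) = 0"
      by (simp add: matrix_add_rdistrib matrix_diff_ldistrib I.cplx J.cplx)
    obtain B where "B ** (I + J) = mat 1" using inv invertible_def by blast
    hence "I - J = B ** ((I + J) ** (I - J))" by (simp add: matrix_mul_assoc)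
    hence "I = J" using matrix_scaleR_right[of B 0 0] by (simp add: 0)
    thus False using ne by simp
  qed
  have "?r *\<^sub>R ((I + J) ** (I + J)) = c *\<^sub>R mat 1"
    using c eq by (simp add: scaleR_add_right[symmetric] matrix_scaleR_left del: scaleR_add_right)
  hence "(I + J) ** (I + J) = (c / ?r) *\<^sub>R mat 1"
    using I.pf_nonzero by (metis divide_inverse_commute scaleR_left_imp_eq scaleR_scaleR nonzero_mult_div_cancel_left times_divide_eq_right)
  thus ?thesis using that eq by blast
qed

text \<open>The inverse of \<open>I + J\<close> is a multiple of \<open>I + J\<close>, and
  \<open>H\<close> forces \<open>\<eta>\<^sup>\<sharp> = - \<theta>\<^sup>\<sharp>\<close>. With
  \<open>a = \<theta>\<^sup>\<sharp>\<close> and \<open>v\<close> the gradient dual to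
  \<open>d\<close>, the expansion leaves multiples of \<open>g(I a, v)\<close> and
  \<open>g(J a, v)\<close>, which vanish by \<open>fI\<close> and \<open>fJ\<close>.\<close>

lemma F_form_eq_0:
  assumes I: "hermitian4 G I" and J: "hermitian4 G J" and inv: "invertible (I + J)"
    and H: "\<And>a b c. wedge12 (transpose I *v \<theta>) (hermitian4.W G I) a b c =
                  - wedge12 (transpose J *v \<eta>) (hermitian4.W G J) a b c"
    and fI: "d \<bullet> (hodge (hermitian4.W G I) *v \<theta>) = 0"
    and fJ: "d \<bullet> (hodge (hermitian4.W G J) *v \<eta>) = 0"
  shows "F_form G (I + J) ((1/2) *\<^sub>R (I *v (matrix_inv G *v \<theta> - matrix_inv G *v d)))
           ((1/2) *\<^sub>R (J *v (matrix_inv G *v \<eta> - matrix_inv G *v d))) = 0"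
proof -
  interpret I: hermitian4 G I by fact
  interpret J: hermitian4 G J by fact
  obtain k where k: "(I + J) ** (I + J) = k *\<^sub>R mat 1" and eq: "I.\<rho> = J.\<rho>"
    using hermitian4_pair[OF I J inv] by blast
  have k0: "k \<noteq> 0"
  proof
    assume "k = 0"
    hence 0: "(I + J) ** (I + J) = 0" by (simp add: k)
    obtain B where B: "B ** (I + J) = mat 1" using inv invertible_def by blast
    hence "I + J = B ** ((I + J) ** (I + J))" by (simp add: matrix_mul_assoc)
    hence "I + J = 0" using matrix_scaleR_right[of B 0 0] by (simp add: 0)
    hence "(mat 1 :: real^4^4) = 0" using B matrix_scaleR_right[of B 0 0] by simp
    from arg_cong[OF this, of "\<lambda>A. A $ 1 $ 1"] show False by (simp add: mat_def)
  qed
  have Kinv: "matrix_inv (I + J) = (1 / k) *\<^sub>R (I + J)"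
    by (rule matrix_inv_eqI) (simp add: matrix_scaleR_right k k0)
  let ?a = "matrix_inv G *v \<theta>" and ?v = "matrix_inv G *v d"
  \<comment> \<open>This is \<open>dual3\<close> applied to \<open>H\<close>;
    \<open>S_KT_vec\<close> turns both sides into raised covectors scaled by the common
    Pfaffian.\<close>
  have "I.S *v (transpose I *v \<theta>) = - (J.S *v (transpose J *v \<eta>))"
    using H by (simp flip: dual3_wedge12[OF I.skew] dual3_wedge12[OF J.skew] add: dual3_def vec_eq_iff forall_4)
  hence "J.\<rho> *\<^sub>R (matrix_inv G *v \<eta>) = J.\<rho> *\<^sub>R (- ?a)"
    by (simp add: I.S_KT_vec J.S_KT_vec eq del: transpose_matrix_vector)
  hence eta: "matrix_inv G *v \<eta> = - ?a" using J.pf_nonzero by (simp del: scaleR_minus_right)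
  have Gv: "gprod G u ?v = u \<bullet> d" for u
    by (simp add: gprod_def matrix_vector_mul_assoc I.matrix_inv_G_mult)
  have oI: "gprod G (I *v ?a) ?v = 0" and oJ: "gprod G (J *v ?a) ?v = 0"
    using fI fJ eta I.pf_nonzero J.pf_nonzero by (simp_all add: Gv I.S_vec J.S_vec inner_commute matrix_vector_uminus)
  have sym: "gprod G u (I *v w) = - gprod G w (I *v u)" "gprod G u (J *v w) = - gprod G w (J *v u)" for u w
    using I.gprod_skew[of w u] J.gprod_skew[of w u] I.gprod_commute[of "I *v w" u] I.gprod_commute[of "J *v w" u] by auto
  \<comment> \<open>Up to a scalar this is the claim: in the second field
    \<open>\<eta>\<^sup>\<sharp> - v\<close> equals \<open>- (?a + ?v)\<close>, and its sign goes
    into the scalar.\<close>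
  have "gprod G ((I + J) *v (I *v (?a - ?v))) (J *v (?a + ?v)) = 0"
  proof -
    define p q where "p = ?a - ?v" and "q = ?a + ?v"
    have "I *v (I *v p) = - p" by (simp add: matrix_vector_mul_assoc I.cplx matrix_vector_uminus)
    hence "(I + J) *v (I *v p) = - p + J *v (I *v p)" by (simp add: matrix_vector_mult_add_rdistrib)
    \<comment> \<open>Compatibility of \<open>J\<close> removes \<open>J\<close> from both arguments
      of \<open>g(J I p, J q)\<close>.\<close>
    hence "gprod G ((I + J) *v (I *v p)) (J *v q) = - gprod G p (J *v q) + gprod G (I *v p) q"
      using J.compat[of "I *v p" q] by (simp add: gprod_def inner_diff_left)
    also have "gprod G p (J *v q) = gprod G ?a (J *v ?v) - gprod G ?v (J *v ?a) + gprod G ?a (J *v ?a) - gprod G ?v (J *v ?v)"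
      by (simp add: p_def q_def gprod_def algebra_simps inner_simps)
    also have "gprod G (I *v p) q = gprod G (I *v ?a) ?v - gprod G (I *v ?v) ?a + gprod G (I *v ?a) ?a - gprod G (I *v ?v) ?v"
      by (simp add: p_def q_def gprod_def algebra_simps inner_simps)
    finally show ?thesis
      using oI oJ sym(2)[of ?a ?v] sym(2)[of ?a ?a] sym(2)[of ?v ?v] I.gprod_commute[of ?v]
        I.gprod_skew[of ?a ?v] I.gprod_skew[of ?v ?v] I.gprod_skew[of ?a ?a] I.gprod_commute[of ?a] I.gprod_commute[of "I *v ?v" ?v]
      unfolding p_def q_def by (smt (verit))
  qed
  moreover have "(I + J) *v (c *\<^sub>R u) = c *\<^sub>R ((I + J) *v u)" "J *v (- u) = - (J *v u)" for c u
    by (simp_all add: matrix_vector_mult_scaleR) (metis matrix_vector_mult_scaleR scaleR_minus1_left)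
  moreover have "- ?a - ?v = - (?a + ?v)" by simp
  ultimately show ?thesis
    unfolding F_form_def Kinv eta
    by (simp only: gprod_def scaleR_matrix_vector_assoc[symmetric] matrix_vector_mult_scaleR inner_scaleR_left inner_scaleR_right
        inner_minus_right) (simp add: gprod_def matrix_vector_mult_scaleR matrix_vector_uminus flip: scaleR_matrix_vector_assoc)
qed

text \<open>Apply \<open>F_form_eq_0\<close> to \<open>- J\<close>: the 3-form
  \<open>(\<eta> \<circ> J) \<and> \<omega>\<^sub>J\<close> is even in \<open>J\<close>, while
  \<open>\<omega>\<^sub>J\<close> and the second vector only change sign.\<close>

lemma F_form_minus_eq_0:
  assumes I: "hermitian4 G I" and J: "hermitian4 G J" and inv: "invertible (I - J)"
    and H: "\<And>a b c. wedge12 (transpose I *v \<theta>) (hermitian4.W G I) a b c =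
                  - wedge12 (transpose J *v \<eta>) (hermitian4.W G J) a b c"
    and fI: "d \<bullet> (hodge (hermitian4.W G I) *v \<theta>) = 0"
    and fJ: "d \<bullet> (hodge (hermitian4.W G J) *v \<eta>) = 0"
  shows "F_form G (I - J) ((1/2) *\<^sub>R (I *v (matrix_inv G *v \<theta> - matrix_inv G *v d)))
           ((1/2) *\<^sub>R (J *v (matrix_inv G *v \<eta> - matrix_inv G *v d))) = 0"
proof -
  have W: "hermitian4.W G (- J) = - hermitian4.W G J"
    by (simp add: hermitian4.W_def[OF hermitian4_uminus[OF J]] hermitian4.W_def[OF J] transpose_uminus matrix_uminus_left)
  have "wedge12 (transpose (- J) *v \<eta>) (hermitian4.W G (- J)) a b c =
      wedge12 (transpose J *v \<eta>) (hermitian4.W G J) a b c" for a b c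
    unfolding W transpose_uminus matrix_vector_uminus wedge12_def by simp
  hence "wedge12 (transpose I *v \<theta>) (hermitian4.W G I) a b c =
      - wedge12 (transpose (- J) *v \<eta>) (hermitian4.W G (- J)) a b c" for a b c
    by (simp only: H)
  moreover have "d \<bullet> (hodge (hermitian4.W G (- J)) *v \<eta>) = 0"
    using fJ by (simp add: W hodge_uminus matrix_vector_uminus)
  ultimately have "F_form G (I + - J) ((1/2) *\<^sub>R (I *v (matrix_inv G *v \<theta> - matrix_inv G *v d)))
           ((1/2) *\<^sub>R (- J *v (matrix_inv G *v \<eta> - matrix_inv G *v d))) = 0"
    using inv by (intro F_form_eq_0 I hermitian4_uminus J fI) auto
  thus ?thesis by (simp add: F_form_def gprod_def matrix_vector_uminus)
qed

text \<open>As \<omega> has type \<open>(1,1)\<close>, the parts of \<theta> \<and> \<omega> are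
  \<open>\<theta>\<^sup>0\<^sup>,\<^sup>1 \<and> \<omega>\<close> and
  \<open>\<theta>\<^sup>1\<^sup>,\<^sup>0 \<and> \<omega>\<close>, and \<open>\<i>
  (\<theta>\<^sup>0\<^sup>,\<^sup>1 - \<theta>\<^sup>1\<^sup>,\<^sup>0) = - \<theta> \<circ>
  K\<close>. The proof verifies this by expanding the complexification.\<close>

lemma type_part_wedge:
  fixes K W :: "real^4^4"
  assumes \<alpha>: "\<And>u v w. \<alpha> [u, v, w] = \<theta> \<bullet> u * (v \<bullet> (W *v w)) - \<theta> \<bullet> v * (u \<bullet> (W *v w)) + \<theta> \<bullet> w * (u \<bullet> (W *v v))"
    and K: "\<And>u v. (K *v u) \<bullet> (W *v (K *v v)) = u \<bullet> (W *v v)" "\<And>u v. (K *v u) \<bullet> (W *v v) = - (u \<bullet> (W *v (K *v v)))"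
  shows "\<i> * (type_part 1 K \<alpha> [u, v, w] - type_part 2 K \<alpha> [u, v, w]) =
    - complex_of_real (\<theta> \<bullet> (K *v u) * (v \<bullet> (W *v w)) - \<theta> \<bullet> (K *v v) * (u \<bullet> (W *v w)) + \<theta> \<bullet> (K *v w) * (u \<bullet> (W *v v)))"
proof -
  \<comment> \<open>The sets record which of the three arguments are projected to
    \<open>T\<^sup>1\<^sup>,\<^sup>0\<close>.\<close>
  have s1: "{T. T \<subseteq> {..<3::nat} \<and> card T = 1} = {{0}, {1}, {2}}"
    by (auto simp: card_1_singleton_iff lessThan_nat_numeral lessThan_Suc numeral_3_eq_3 eval_nat_numeral)
  have s2: "{T. T \<subseteq> {..<3::nat} \<and> card T = 2} = {{0,1}, {0,2}, {1,2}}"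
  proof -
    have "T \<in> {{0,1}, {0,2}, {1,2}}" if "T \<subseteq> {..<3::nat}" "card T = 2" for T
    proof -
      obtain x y where "T = {x, y}" "x \<noteq> y" using \<open>card T = 2\<close> card_2_iff by metis
      moreover from this have "x = 0 \<or> x = 1 \<or> x = 2" "y = 0 \<or> y = 1 \<or> y = 2" using that(1) by auto
      ultimately show ?thesis by (auto simp: doubleton_eq_iff)
    qed
    thus ?thesis by auto
  qed
  have n3: "length [u, v, w] = 3" and u3: "[0..<3] = [0,1,2]" by (simp_all add: upt_rec)
  have c: "complexify \<alpha> [x, y, z] =
     (let a = (\<chi> i. Re (x $ i)); a' = (\<chi> i. Im (x $ i)); b = (\<chi> i. Re (y $ i)); b' = (\<chi> i. Im (y $ i));
          c = (\<chi> i. Re (z $ i)); c' = (\<chi> i. Im (z $ i)) in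
      \<alpha> [a,b,c] + \<i> * \<alpha> [a,b,c'] + \<i> * \<alpha> [a,b',c] - \<alpha> [a,b',c'] + \<i> * \<alpha> [a',b,c] - \<alpha> [a',b,c'] - \<alpha> [a',b',c] - \<i> * \<alpha> [a',b',c'])" for x y z
    by (simp add: Let_def algebra_simps)
  have p: "(\<chi> i. Re (proj10 K x $ i)) = (1/2) *\<^sub>R x" "(\<chi> i. Im (proj10 K x $ i)) = (-1/2) *\<^sub>R (K *v x)"
    "(\<chi> i. Re (proj01 K x $ i)) = (1/2) *\<^sub>R x" "(\<chi> i. Im (proj01 K x $ i)) = (1/2) *\<^sub>R (K *v x)" for x
    by (simp_all add: vec_eq_iff proj10_def proj01_def)
  let ?P = "proj10 K" and ?Q = "proj01 K"
  have t1: "type_part 1 K \<alpha> [u, v, w] =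
      complexify \<alpha> [?P u, ?Q v, ?Q w] + complexify \<alpha> [?Q u, ?P v, ?Q w] + complexify \<alpha> [?Q u, ?Q v, ?P w]"
    unfolding type_part_def n3 s1 u3 by (simp del: complexify.simps)
  have t2: "type_part 2 K \<alpha> [u, v, w] =
      complexify \<alpha> [?P u, ?P v, ?Q w] + complexify \<alpha> [?P u, ?Q v, ?P w] + complexify \<alpha> [?Q u, ?P v, ?P w]"
    unfolding type_part_def n3 s2 u3 by (simp del: complexify.simps add: doubleton_eq_iff)
  show ?thesis
    unfolding t1 t2 c Let_def p \<alpha>
    by (simp add: complex_eq_iff matrix_vector_mult_scaleR matrix_vector_uminus K(1) K(2)[of u v] K(2)[of u w] K(2)[of v w] algebra_simps)
qed

section \<open>The Lee form in a chart\<close>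

lemma inner_matrix_expand:
  fixes M :: "real^4^4"
  shows "v \<bullet> (M *v w) = (\<Sum>b\<in>UNIV. \<Sum>c\<in>UNIV. v$b * w$c * M$b$c)"
  by (simp add: inner_vec_def matrix_vector_mult_def sum_distrib_left algebra_simps)

lemma frechet_derivative_bilinear:
  fixes M :: "real^4 \<Rightarrow> real^4^4"
  assumes "\<And>b c. (\<lambda>y. M y $ b $ c) differentiable (at x)"
  shows "(\<lambda>y. v \<bullet> (M y *v w)) differentiable (at x)"
    and "frechet_derivative (\<lambda>y. v \<bullet> (M y *v w)) (at x) u =
      (\<Sum>a\<in>UNIV. \<Sum>b\<in>UNIV. \<Sum>c\<in>UNIV. u$a * v$b * w$c * partial_deriv a (\<lambda>y. M y $ b $ c) x)"
proof -
  show 1: "(\<lambda>y. v \<bullet> (M y *v w)) differentiable (at x)"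
    unfolding inner_matrix_expand using assms by (intro differentiable_sum ballI differentiable_mult differentiable_const) auto
  have "partial_deriv a (\<lambda>y. v \<bullet> (M y *v w)) x = (\<Sum>b\<in>UNIV. \<Sum>c\<in>UNIV. v$b * w$c * partial_deriv a (\<lambda>y. M y $ b $ c) x)" for a
    unfolding inner_matrix_expand using assms by (simp add: partial_deriv_sum partial_deriv_cmult)
  thus "frechet_derivative (\<lambda>y. v \<bullet> (M y *v w)) (at x) u =
      (\<Sum>a\<in>UNIV. \<Sum>b\<in>UNIV. \<Sum>c\<in>UNIV. u$a * v$b * w$c * partial_deriv a (\<lambda>y. M y $ b $ c) x)"
    by (simp add: frechet_derivative_expand[OF 1] sum_distrib_left mult.assoc)
qed

lemma sum_mult_inner_matrix:
  fixes M :: "real^4^4"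
  shows "(\<Sum>a\<in>UNIV. u$a * x$a) * (v \<bullet> (M *v w)) =
    (\<Sum>a\<in>UNIV. \<Sum>b\<in>UNIV. \<Sum>c\<in>UNIV. u$a * v$b * w$c * ((x :: real^4)$a * M$b$c))"
  unfolding inner_matrix_expand by (subst sum_distrib_right) (simp add: sum_distrib_left ac_simps)

lemma length_3_iff: "length vs = 3 \<longleftrightarrow> (\<exists>u v w. vs = [u, v, w])"
  by (auto simp: numeral_3_eq_3 length_Suc_conv)

lemma sum_lessThan_3: "(\<Sum>i<3. h i) = h 0 + h 1 + h (2::nat)" for h :: "nat \<Rightarrow> real"
  by (simp add: numeral_3_eq_3 numeral_2_eq_2)

lemma ext_deriv_3: "ext_deriv \<alpha> x [u, v, w] =
    frechet_derivative (\<lambda>y. \<alpha> y [v, w]) (at x) u - frechet_derivative (\<lambda>y. \<alpha> y [u, w]) (at x) v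
    + frechet_derivative (\<lambda>y. \<alpha> y [u, v]) (at x) w"
proof -
  have "length [u, v, w] = 3" by simp
  thus ?thesis unfolding ext_deriv_def by (simp only: sum_lessThan_3) (simp add: numeral_2_eq_2)
qed

lemma wedge1_3: "wedge1 \<theta> \<alpha> [u, v, w] = \<theta> \<bullet> u * \<alpha> [v, w] - \<theta> \<bullet> v * \<alpha> [u, w] + \<theta> \<bullet> w * \<alpha> [u, v]"
proof -
  have "length [u, v, w] = 3" by simp
  thus ?thesis unfolding wedge1_def by (simp only: sum_lessThan_3) (simp add: numeral_2_eq_2)
qed

lemma wedge12_alt:
  assumes "transpose W = - W"
  shows "wedge12 \<eta> W b a c = - wedge12 \<eta> W a b c" "wedge12 \<eta> W a c b = - wedge12 \<eta> W a b c"
  unfolding wedge12_def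
  using skew_entry[OF assms, of a c] skew_entry[OF assms, of c b] skew_entry[OF assms, of b a]
  by (simp_all add: algebra_simps)

text \<open>Renaming summation indices brings the second and third products to the order
  \<open>a\<close>, \<open>b\<close>, \<open>c\<close>; skewness of \<open>M\<close> turns the minus
  sign into the cyclic pattern of \<open>wedge12\<close>.\<close>

lemma wedge12_expand:
  assumes M: "transpose M = - M"
  shows "(\<Sum>a\<in>UNIV. u$a * x$a) * (v \<bullet> (M *v w)) - (\<Sum>a\<in>UNIV. v$a * x$a) * (u \<bullet> (M *v w))
      + (\<Sum>a\<in>UNIV. w$a * x$a) * (u \<bullet> (M *v v)) =
    (\<Sum>a\<in>UNIV. \<Sum>b\<in>UNIV. \<Sum>c\<in>UNIV. u$a * v$b * w$c * wedge12 x M a b c)"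
proof -
  have 2: "(\<Sum>a\<in>UNIV. v$a * x$a) * (u \<bullet> (M *v w)) =
      (\<Sum>a\<in>UNIV. \<Sum>b\<in>UNIV. \<Sum>c\<in>UNIV. u$a * v$b * w$c * - (x $ b * M $ c $ a))"
    unfolding sum_mult_inner_matrix
    by (subst sum.swap) (intro sum.cong refl, subst skew_entry[OF M], simp add: ac_simps)
  have 3: "(\<Sum>a\<in>UNIV. w$a * x$a) * (u \<bullet> (M *v v)) =
      (\<Sum>a\<in>UNIV. \<Sum>b\<in>UNIV. \<Sum>c\<in>UNIV. u$a * v$b * w$c * (x $ c * M $ a $ b))"
    unfolding sum_mult_inner_matrix
    by (subst sum.swap, rule sum.cong[OF refl], subst sum.swap) (simp add: ac_simps)
  show ?thesis
    unfolding sum_mult_inner_matrix[of u x v M w] 2 3 wedge12_def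
    by (simp add: sum_subtractf[symmetric] sum.distrib[symmetric] algebra_simps)
qed

section \<open>The fundamental form, its differential and its Lee form in one chart\<close>

locale hermitian_chart =
  fixes U :: "(real^4) set" and G K :: "real^4 \<Rightarrow> real^4^4"
  assumes open_U: "open U"
    and G_entry: "twice_differentiable_on U (\<lambda>y. G y $ a $ b)"
    and K_entry: "twice_differentiable_on U (\<lambda>y. K y $ a $ b)"
    and hermitian: "y \<in> U \<Longrightarrow> hermitian4 (G y) (K y)"
begin

definition W :: "real^4 \<Rightarrow> real^4^4" where "W y = transpose (K y) ** G y"

lemma W_eq: "y \<in> U \<Longrightarrow> hermitian4.W (G y) (K y) = W y"
  by (simp add: hermitian4.W_def[OF hermitian] W_def)

lemma W_entry: "twice_differentiable_on U (\<lambda>y. W y $ a $ b)"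
  unfolding W_def matrix_matrix_mult_def transpose_def
  by (simp, intro twice_differentiable_on_sum twice_differentiable_on_mult open_U G_entry K_entry)

lemma W_skew: "y \<in> U \<Longrightarrow> transpose (W y) = - W y"
  using hermitian4.skew[OF hermitian] W_eq by simp

lemmas D = twice_differentiable_onD

lemma dW_skew:
  assumes "y \<in> U"
  shows "partial_deriv a (\<lambda>y. W y $ c $ b) y = - partial_deriv a (\<lambda>y. W y $ b $ c) y"
proof -
  have "partial_deriv a (\<lambda>y. W y $ c $ b) y = partial_deriv a (\<lambda>y. - W y $ b $ c) y"
    by (rule partial_deriv_cong[OF open_U assms]) (rule skew_entry[OF W_skew])
  thus ?thesis using assms by (simp add: partial_deriv_uminus D(1)[OF W_entry])
qed

definition dW :: "real^4 \<Rightarrow> 4 \<Rightarrow> 4 \<Rightarrow> 4 \<Rightarrow> real" where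
  "dW y a b c = partial_deriv a (\<lambda>y. W y $ b $ c) y + partial_deriv b (\<lambda>y. W y $ c $ a) y
     + partial_deriv c (\<lambda>y. W y $ a $ b) y"

text \<open>The vector dual to \<open>d\<omega>\<close>, because the constant permutation symbol
  passes through the derivatives.\<close>

definition div_hodge :: "real^4 \<Rightarrow> real^4" where
  "div_hodge y = (\<chi> l. \<Sum>k\<in>UNIV. partial_deriv k (\<lambda>y. hodge (W y) $ l $ k) y)"

text \<open>Since \<open>- W / pf W\<close> inverts \<open>hodge W\<close>, this solves
  \<open>hodge (W y) *v lee y = div_hodge y\<close>, the dual form of
  \<open>d\<omega> = \<theta> \<and> \<omega>\<close>.\<close>

definition lee :: "real^4 \<Rightarrow> real^4" where
  "lee y = (- 1 / pf (W y)) *\<^sub>R (W y *v div_hodge y)"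

lemma pf_W: "y \<in> U \<Longrightarrow> pf (W y) \<noteq> 0"
  using hermitian4.pf_nonzero[OF hermitian] W_eq by simp

lemma dual3_dW: "y \<in> U \<Longrightarrow> dual3 (dW y) = div_hodge y"
  using dW_skew[of y _ 1 4] dW_skew[of y _ 1 2] dW_skew[of y _ 1 3]  dW_skew[of y _ 2 4]  dW_skew[of y _ 3 4] dW_skew[of y _ 2 3]
  by (simp add: dual3_def dW_def div_hodge_def vec_eq_iff forall_4 sum_4 hodge_def partial_deriv_const
      partial_deriv_uminus D(1)[OF W_entry])

lemma hodge_lee: "y \<in> U \<Longrightarrow> hodge (W y) *v lee y = div_hodge y"
  by (simp add: lee_def matrix_vector_mult_scaleR matrix_vector_mul_assoc mult_hodge[OF W_skew] pf_W matrix_vector_uminus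
      flip: scaleR_matrix_vector_assoc)

text \<open>Both sides are totally skew, so it suffices that their dual vectors agree, which is how
  \<open>lee\<close> was chosen.\<close>

lemma dW_lee:
  assumes y: "y \<in> U" shows "dW y a b c = wedge12 (lee y) (W y) a b c"
proof (rule dual3_inj)
  show "dual3 (dW y) = dual3 (wedge12 (lee y) (W y))"
    using y by (simp add: dual3_dW dual3_wedge12 W_skew hodge_lee)
next
  fix a b c
  show "dW y b a c = - dW y a b c" "dW y a c b = - dW y a b c"
    unfolding dW_def using dW_skew[OF y, of b a c] dW_skew[OF y, of a c b] dW_skew[OF y, of c b a] by linarith+
  show "wedge12 (lee y) (W y) b a c = - wedge12 (lee y) (W y) a b c"
    "wedge12 (lee y) (W y) a c b = - wedge12 (lee y) (W y) a b c"
    by (rule wedge12_alt[OF W_skew[OF y]])+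
qed

lemma fund_form_eq: "fund_form G K y [u, v] = u \<bullet> (W y *v v)"
  unfolding fund_form_def gprod_def W_def
  by (simp add: matrix_vector_mul_assoc[symmetric] flip: transpose_matrix_vector dot_lmul_matrix)

lemma ext_deriv_axis:
  assumes y: "y \<in> U"
  shows "ext_deriv (fund_form G K) y [u, v, w] = (\<Sum>a\<in>UNIV. \<Sum>b\<in>UNIV. \<Sum>c\<in>UNIV. u$a * v$b * w$c * dW y a b c)"
proof -
  note fd = frechet_derivative_bilinear(2)[of W, OF D(1)[OF W_entry y]]
  have 2: "(\<Sum>a\<in>UNIV. \<Sum>b\<in>UNIV. \<Sum>c\<in>UNIV. v$a * u$b * w$c * partial_deriv a (\<lambda>y. W y $ b $ c) y)
     = (\<Sum>a\<in>UNIV. \<Sum>b\<in>UNIV. \<Sum>c\<in>UNIV. u$a * v$b * w$c * - partial_deriv b (\<lambda>y. W y $ c $ a) y)"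
    by (subst sum.swap, intro sum.cong refl, subst dW_skew[OF y]) (simp add: ac_simps)
  have 3: "(\<Sum>a\<in>UNIV. \<Sum>b\<in>UNIV. \<Sum>c\<in>UNIV. w$a * u$b * v$c * partial_deriv a (\<lambda>y. W y $ b $ c) y)
     = (\<Sum>a\<in>UNIV. \<Sum>b\<in>UNIV. \<Sum>c\<in>UNIV. u$a * v$b * w$c * partial_deriv c (\<lambda>y. W y $ a $ b) y)"
    by (subst sum.swap, rule sum.cong[OF refl], subst sum.swap) (simp add: ac_simps)
  show ?thesis
    unfolding ext_deriv_3 fund_form_eq fd 2 3 dW_def
    by (simp add: sum_subtractf[symmetric] sum.distrib[symmetric] algebra_simps)
qed

lemma ext_deriv_lee:
  assumes y: "y \<in> U"
  shows "ext_deriv (fund_form G K) y [u, v, w] = wedge1 (lee y) (fund_form G K y) [u, v, w]"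
proof -
  have "lee y \<bullet> u = (\<Sum>a\<in>UNIV. u$a * lee y $ a)" for u by (simp add: inner_vec_def mult.commute)
  thus ?thesis
    unfolding ext_deriv_axis[OF y] dW_lee[OF y] wedge1_3 fund_form_eq
    using wedge12_expand[OF W_skew[OF y], of u "lee y" v w] by simp
qed

text \<open>Existence is \<open>ext_deriv_lee\<close>. For uniqueness, coordinate triples recover
  the components of \<theta> \<and> \<omega>; their dual is \<open>hodge (W y) *v \<theta>\<close>,
  and \<open>hodge (W y)\<close> is invertible.\<close>

lemma lee_form_eq:
  assumes y: "y \<in> U"
  shows "lee_form G K y = lee y"
  unfolding lee_form_def
proof (rule the_equality)
  show "\<forall>vs. length vs = 3 \<longrightarrow> ext_deriv (fund_form G K) y vs = wedge1 (lee y) (fund_form G K y) vs"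
    using ext_deriv_lee[OF y] by (auto simp: length_3_iff)
next
  fix \<theta> assume *: "\<forall>vs. length vs = 3 \<longrightarrow> ext_deriv (fund_form G K) y vs = wedge1 \<theta> (fund_form G K y) vs"
  have entry: "axis b 1 \<bullet> (W y *v axis c 1) = W y $ b $ c" for b c :: 4
    by (simp add: inner_axis' matrix_vector_mult_basis column_def)
  have "wedge1 \<eta> (fund_form G K y) [axis a 1, axis b 1, axis c 1] = wedge12 \<eta> (W y) a b c" for \<eta> a b c
    unfolding wedge1_3 fund_form_eq entry using skew_entry[OF W_skew[OF y], of c a]
    by (simp add: inner_axis wedge12_def)
  hence "wedge12 \<theta> (W y) a b c = wedge12 (lee y) (W y) a b c" for a b c
    using *[rule_format, of "[axis a 1, axis b 1, axis c 1]"] ext_deriv_lee[OF y] by simp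
  hence "wedge12 \<theta> (W y) = wedge12 (lee y) (W y)" by (intro ext)
  hence "hodge (W y) *v \<theta> = hodge (W y) *v lee y"
    by (simp flip: dual3_wedge12[OF W_skew[OF y]])
  hence "W y *v (hodge (W y) *v \<theta>) = W y *v (hodge (W y) *v lee y)" by simp
  thus "\<theta> = lee y"
    by (simp add: matrix_vector_mul_assoc hodge_mult[OF W_skew[OF y]] pf_W[OF y] matrix_vector_uminus
      flip: scaleR_matrix_vector_assoc)
qed

text \<open>With \<open>d\<omega> = \<theta> \<and> \<omega>\<close>, \<open>type_part_wedge\<close>
  yields \<open>d\<^sup>c\<omega> = - (\<theta> \<circ> K) \<and> \<omega>\<close>.\<close>

lemma dc_fund_eq:
  assumes y: "y \<in> U"
  shows "dc_fund G K y [u, v, w] = - complex_of_real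
    (lee y \<bullet> (K y *v u) * (v \<bullet> (W y *v w)) - lee y \<bullet> (K y *v v) * (u \<bullet> (W y *v w)) + lee y \<bullet> (K y *v w) * (u \<bullet> (W y *v v)))"
proof -
  have "\<i> * (type_part 1 (K y) (ext_deriv (fund_form G K) y) [u, v, w] - type_part 2 (K y) (ext_deriv (fund_form G K) y) [u, v, w])
    = - complex_of_real (lee y \<bullet> (K y *v u) * (v \<bullet> (W y *v w)) - lee y \<bullet> (K y *v v) * (u \<bullet> (W y *v w)) + lee y \<bullet> (K y *v w) * (u \<bullet> (W y *v v)))"
    by (rule type_part_wedge)
      (use hermitian4.W_compat[OF hermitian[OF y]] W_eq[OF y] ext_deriv_lee[OF y] in \<open>auto simp: wedge1_3 fund_form_eq\<close>)
  thus ?thesis by (simp add: dc_fund_def del_def delbar_def numeral_2_eq_2)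
qed

lemma inner_K: "\<theta> \<bullet> (K y *v u) = (\<Sum>a\<in>UNIV. u$a * (transpose (K y) *v \<theta>) $ a)"
  unfolding inner_vec_def matrix_vector_mult_def transpose_def
  by (simp add: sum_distrib_left sum_distrib_right) (subst sum.swap, simp add: ac_simps)

lemma dc_fund_axis:
  assumes y: "y \<in> U"
  shows "dc_fund G K y [u, v, w] = complex_of_real (\<Sum>a\<in>UNIV. \<Sum>b\<in>UNIV. \<Sum>c\<in>UNIV.
      u$a * v$b * w$c * - wedge12 (transpose (K y) *v lee y) (W y) a b c)"
  unfolding dc_fund_eq[OF y] inner_K wedge12_expand[OF W_skew[OF y]]
  by (simp add: sum_negf del: transpose_matrix_vector)

end

section \<open>The skew part of the soliton equation\<close>

text \<open>
  \<open>N\<close> and \<open>T\<close> are the Christoffel symbols of a torsion-free connection and the skew part of a connection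
  with torsion, \<open>E\<close> is the Ricci tensor of their sum, and \<open>dN\<close>, \<open>dT\<close> stand for the partial derivatives.
\<close>

lemma skew_ricci_algebra:
  fixes N T :: "'n::finite \<Rightarrow> 'n \<Rightarrow> 'n \<Rightarrow> real" and dN dT :: "'n \<Rightarrow> 'n \<Rightarrow> 'n \<Rightarrow> 'n \<Rightarrow> real"
  assumes N: "\<And>a b k. N a b k = N b a k" and dN: "\<And>j a b k. dN j a b k = dN j b a k"
    and T: "\<And>a b k. T a b k = - T b a k" and dT: "\<And>j a b k. dT j a b k = - dT j b a k"
    and T0: "\<And>b. (\<Sum>i\<in>UNIV. T i b i) = 0" and dT0: "\<And>j b. (\<Sum>i\<in>UNIV. dT j i b i) = 0"
    and dL: "\<And>a b. (\<Sum>i\<in>UNIV. dN a i b i) = (\<Sum>i\<in>UNIV. dN b i a i)"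
  defines "E \<equiv> \<lambda>a b. \<Sum>i\<in>UNIV. (dN i a b i + dT i a b i) - (dN a i b i + dT a i b i)
      + (\<Sum>k\<in>UNIV. (N a b k + T a b k) * (N i k i + T i k i)) - (\<Sum>k\<in>UNIV. (N i b k + T i b k) * (N a k i + T a k i))"
  shows "E a b - E b a = 2 * ((\<Sum>i\<in>UNIV. dT i a b i) + (\<Sum>k\<in>UNIV. T a b k * (\<Sum>i\<in>UNIV. N i k i))
      - (\<Sum>i\<in>UNIV. \<Sum>k\<in>UNIV. N i b k * T a k i - N i a k * T b k i))"
proof -
  define X4 where "X4 a b = (\<Sum>i\<in>UNIV. \<Sum>k\<in>UNIV. (N i b k + T i b k) * (N a k i + T a k i))" for a b
  define L where "L k = (\<Sum>i\<in>UNIV. N i k i)" for k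
  have E: "E a b = (\<Sum>i\<in>UNIV. dN i a b i) + (\<Sum>i\<in>UNIV. dT i a b i) - (\<Sum>i\<in>UNIV. dN a i b i)
     + (\<Sum>k\<in>UNIV. (N a b k + T a b k) * L k) - X4 a b" for a b
  proof -
    have "(\<Sum>i\<in>UNIV. \<Sum>k\<in>UNIV. (N a b k + T a b k) * (N i k i + T i k i)) = (\<Sum>k\<in>UNIV. (N a b k + T a b k) * L k)"
      by (subst sum.swap) (simp add: sum_distrib_left[symmetric] sum.distrib T0 L_def)
    thus ?thesis unfolding E_def X4_def
      by (simp add: sum.distrib sum_subtractf dT0)
  qed
  \<comment> \<open>Exchanging \<open>i\<close> and \<open>k\<close> in the sum for
    \<open>(b, a)\<close> reproduces the sum for \<open>(a, b)\<close> with \<open>T\<close>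
    negated. Hence only the terms linear in \<open>T\<close> survive in the difference.\<close>
  have "X4 b a = (\<Sum>i\<in>UNIV. \<Sum>k\<in>UNIV. (N i b k - T i b k) * (N a k i - T a k i))"
    unfolding X4_def
    by (subst sum.swap, intro sum.cong refl) (metis N T add_uminus_conv_diff mult.commute)
  hence "X4 a b - X4 b a = (\<Sum>i\<in>UNIV. \<Sum>k\<in>UNIV. 2 * (N i b k * T a k i)) + (\<Sum>i\<in>UNIV. \<Sum>k\<in>UNIV. 2 * (T i b k * N a k i))"
    unfolding X4_def by (simp add: sum_subtractf[symmetric] sum.distrib[symmetric] algebra_simps)
  also have "(\<Sum>i\<in>UNIV. \<Sum>k\<in>UNIV. 2 * (T i b k * N a k i)) = (\<Sum>i\<in>UNIV. \<Sum>k\<in>UNIV. - 2 * (N i a k * T b k i))"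
    by (subst sum.swap, intro sum.cong refl) (metis N T minus_mult_minus minus_mult_left minus_mult_right mult.commute)
  finally have X4: "X4 a b - X4 b a = 2 * (\<Sum>i\<in>UNIV. \<Sum>k\<in>UNIV. N i b k * T a k i - N i a k * T b k i)"
    by (simp add: sum_subtractf sum_distrib_left sum_negf right_diff_distrib)
  have 1: "(\<Sum>i\<in>UNIV. dN i b a i) = (\<Sum>i\<in>UNIV. dN i a b i)" using dN by metis
  have 2: "(\<Sum>i\<in>UNIV. dT i b a i) = - (\<Sum>i\<in>UNIV. dT i a b i)"
    unfolding sum_negf[symmetric] by (intro sum.cong refl dT)
  have 3: "(\<Sum>k\<in>UNIV. (N b a k + T b a k) * L k) = (\<Sum>k\<in>UNIV. (N a b k - T a b k) * L k)"
    by (intro sum.cong refl) (metis N T add_uminus_conv_diff)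
  have 4: "(\<Sum>k\<in>UNIV. (N a b k + T a b k) * L k) - (\<Sum>k\<in>UNIV. (N a b k - T a b k) * L k) = 2 * (\<Sum>k\<in>UNIV. T a b k * L k)"
    by (simp add: sum_subtractf[symmetric] sum_distrib_left algebra_simps)
  show ?thesis unfolding E 1 2 3 L_def[symmetric] using X4 4 dL[of a b] by (simp add: algebra_simps)
qed

text \<open>Cyclic invariance of \<open>Q\<close> absorbs a rotation of the bound indices. The lemma
  is for pairing \<open>Q\<close> with the cyclic sums \<open>d\<omega>\<close> and \<theta> \<and>
  \<omega>.\<close>

lemma sum_cyclic:
  fixes Q Z :: "'n::finite \<Rightarrow> 'n \<Rightarrow> 'n \<Rightarrow> real"
  assumes "\<And>i c d. Q c d i = Q i c d"
  shows "(\<Sum>i\<in>UNIV. \<Sum>c\<in>UNIV. \<Sum>d\<in>UNIV. Q i c d * (Z i c d + Z c d i + Z d i c)) =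
    3 * (\<Sum>i\<in>UNIV. \<Sum>c\<in>UNIV. \<Sum>d\<in>UNIV. Q i c d * Z i c d)"
proof -
  have 1: "(\<Sum>i\<in>UNIV. \<Sum>c\<in>UNIV. \<Sum>d\<in>UNIV. R c d i) = (\<Sum>i\<in>UNIV. \<Sum>c\<in>UNIV. \<Sum>d\<in>UNIV. R i c d)" for R :: "'n \<Rightarrow> 'n \<Rightarrow> 'n \<Rightarrow> real"
    by (subst sum.swap, rule sum.cong[OF refl], rule sum.swap)
  have 2: "(\<Sum>i\<in>UNIV. \<Sum>c\<in>UNIV. \<Sum>d\<in>UNIV. Q i c d * Z c d i) = (\<Sum>i\<in>UNIV. \<Sum>c\<in>UNIV. \<Sum>d\<in>UNIV. Q i c d * Z i c d)"
    using 1[of "\<lambda>i c d. Q i c d * Z i c d"] assms by simp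
  have 3: "(\<Sum>i\<in>UNIV. \<Sum>c\<in>UNIV. \<Sum>d\<in>UNIV. Q i c d * Z d i c) = (\<Sum>i\<in>UNIV. \<Sum>c\<in>UNIV. \<Sum>d\<in>UNIV. Q i c d * Z i c d)"
    using 1[of "\<lambda>i c d. Q i c d * Z d i c"] assms by simp
  show ?thesis using 2 3 by (simp add: sum.distrib distrib_left)
qed

text \<open>
  \<open>T\<close> is a totally skew tensor with two indices lowered by the metric \<open>g\<close>, and \<open>N\<close> are the Christoffel
  symbols of \<open>g\<close>. In the divergence of \<open>T\<close> the Christoffel terms cancel the derivatives of the two
  lowering factors, as if the divergence had been taken before lowering.
\<close>

lemma torsion_divergence_algebra:
  fixes g :: "'n::finite \<Rightarrow> 'n \<Rightarrow> real" and Q N :: "'n \<Rightarrow> 'n \<Rightarrow> 'n \<Rightarrow> real" and dg dQ \<phi> d\<phi>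
  assumes g: "\<And>a b. g a b = g b a" and dg: "\<And>k a b. dg k a b = dg k b a"
    and N: "\<And>a b l. (\<Sum>k\<in>UNIV. g l k * N a b k) = (1/2) * (dg a b l + dg b a l - dg l a b)"
    and Q: "\<And>i c d. Q c i d = - Q i c d" "\<And>i c d. Q i d c = - Q i c (d :: 'n)"
    and T: "\<And>a b i. T a b i = \<phi> * (\<Sum>c\<in>UNIV. \<Sum>d\<in>UNIV. Q i c d * g c a * g d b)"
    and dT: "\<And>j a b i. dT j a b i = d\<phi> j * (\<Sum>c\<in>UNIV. \<Sum>d\<in>UNIV. Q i c d * g c a * g d b)
       + \<phi> * (\<Sum>c\<in>UNIV. \<Sum>d\<in>UNIV. dQ j i c d * g c a * g d b + Q i c d * dg j c a * g d b + Q i c d * g c a * dg j d b)"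
  shows "(\<Sum>i\<in>UNIV. dT i a b i) - (\<Sum>i\<in>UNIV. \<Sum>k\<in>UNIV. N i b k * T a k i - N i a k * T b k i) =
    (\<Sum>c\<in>UNIV. \<Sum>d\<in>UNIV. (\<Sum>i\<in>UNIV. d\<phi> i * Q i c d + \<phi> * dQ i i c d) * g c a * g d (b :: 'n))"
proof -
  have Qd: "Q d c i = - Q i c d" for i c d
    using Q(1)[of d c i] Q(2)[of c i d] Q(1)[of i c d] by simp
  \<comment> \<open>The factor \<open>g d k\<close> of \<open>T\<close> lowers the index of
    \<open>N\<close>. Of the three metric derivatives, one is symmetric against the skew
    \<open>Q\<close> and drops out; the other two contribute equally and cancel the factor
    \<open>1/2\<close>.\<close>
  have X: "(\<Sum>i\<in>UNIV. \<Sum>k\<in>UNIV. N i b k * T a k i) = \<phi> * (\<Sum>i\<in>UNIV. \<Sum>c\<in>UNIV. \<Sum>d\<in>UNIV. Q i c d * g c a * dg i d b)" for a b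
  proof -
    have e: "(\<Sum>i\<in>UNIV. \<Sum>d\<in>UNIV. Q i c d * dg i b d) = (\<Sum>i\<in>UNIV. \<Sum>d\<in>UNIV. Q i c d * dg i d b)" for c
      by (intro sum.cong refl arg_cong2[where f = "(*)"] dg)
    have z: "(\<Sum>i\<in>UNIV. \<Sum>d\<in>UNIV. Q i c d * dg b i d) = 0" for c
    proof -
      have "(\<Sum>i\<in>UNIV. \<Sum>d\<in>UNIV. Q i c d * dg b i d) = (\<Sum>d\<in>UNIV. \<Sum>i\<in>UNIV. Q i c d * dg b i d)" by (rule sum.swap)
      also have "\<dots> = - (\<Sum>i\<in>UNIV. \<Sum>d\<in>UNIV. Q i c d * dg b i d)"
        unfolding sum_negf[symmetric] by (intro sum.cong refl) (metis Qd dg mult_minus_left)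
      finally show ?thesis by simp
    qed
    have s: "(\<Sum>i\<in>UNIV. \<Sum>d\<in>UNIV. Q i c d * dg d i b) = - (\<Sum>i\<in>UNIV. \<Sum>d\<in>UNIV. Q i c d * dg i d b)" for c
      unfolding sum_negf[symmetric] by (subst sum.swap) (intro sum.cong refl, metis Qd mult_minus_left)
    have "(\<Sum>i\<in>UNIV. \<Sum>k\<in>UNIV. N i b k * T a k i) =
       (\<Sum>i\<in>UNIV. \<Sum>k\<in>UNIV. \<Sum>c\<in>UNIV. \<Sum>d\<in>UNIV. \<phi> * (g c a * (Q i c d * (g d k * N i b k))))"
      by (simp add: T sum_distrib_left sum_distrib_right ac_simps)
    also have "\<dots> = (\<Sum>i\<in>UNIV. \<Sum>c\<in>UNIV. \<Sum>k\<in>UNIV. \<Sum>d\<in>UNIV. \<phi> * (g c a * (Q i c d * (g d k * N i b k))))"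
      by (intro sum.cong refl sum.swap)
    also have "\<dots> = (\<Sum>c\<in>UNIV. \<Sum>i\<in>UNIV. \<Sum>d\<in>UNIV. \<Sum>k\<in>UNIV. \<phi> * (g c a * (Q i c d * (g d k * N i b k))))"
      by (subst sum.swap, rule sum.cong[OF refl], rule sum.cong[OF refl], rule sum.swap)
    also have "\<dots> = (\<Sum>c\<in>UNIV. \<Sum>i\<in>UNIV. \<Sum>d\<in>UNIV. \<phi> * (g c a * (Q i c d * ((1/2) * (dg i b d + dg b i d - dg d i b)))))"
      by (simp add: sum_distrib_left[symmetric] N)
    also have "\<dots> = (\<Sum>c\<in>UNIV. \<phi> * (g c a * ((1/2) * ((\<Sum>i\<in>UNIV. \<Sum>d\<in>UNIV. Q i c d * dg i b d)
         + (\<Sum>i\<in>UNIV. \<Sum>d\<in>UNIV. Q i c d * dg b i d) - (\<Sum>i\<in>UNIV. \<Sum>d\<in>UNIV. Q i c d * dg d i b)))))"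
      by (simp add: sum_distrib_left sum.distrib[symmetric] sum_subtractf[symmetric] algebra_simps)
    also have "\<dots> = (\<Sum>c\<in>UNIV. \<phi> * (g c a * (\<Sum>i\<in>UNIV. \<Sum>d\<in>UNIV. Q i c d * dg i d b)))"
      unfolding z s e by simp
    also have "\<dots> = \<phi> * (\<Sum>i\<in>UNIV. \<Sum>c\<in>UNIV. \<Sum>d\<in>UNIV. Q i c d * g c a * dg i d b)"
      by (subst sum.swap) (simp add: sum_distrib_left ac_simps)
    finally show ?thesis .
  qed
  \<comment> \<open>This is \<open>X\<close> with \<open>a\<close> and \<open>b\<close> exchanged;
    renaming \<open>c\<close> and \<open>d\<close> then costs a sign.\<close>
  have Y: "(\<Sum>i\<in>UNIV. \<Sum>k\<in>UNIV. N i a k * T b k i) = - \<phi> * (\<Sum>i\<in>UNIV. \<Sum>c\<in>UNIV. \<Sum>d\<in>UNIV. Q i c d * dg i c a * g d b)"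
  proof -
    have "(\<Sum>c\<in>UNIV. \<Sum>d\<in>UNIV. Q i c d * g c b * dg i d a) = - (\<Sum>c\<in>UNIV. \<Sum>d\<in>UNIV. Q i c d * dg i c a * g d b)" for i
      unfolding sum_negf[symmetric] by (subst sum.swap) (intro sum.cong refl, subst Q(2), simp)
    thus ?thesis unfolding X by (simp add: sum_negf)
  qed
  have "(\<Sum>i\<in>UNIV. dT i a b i) = (\<Sum>c\<in>UNIV. \<Sum>d\<in>UNIV. (\<Sum>i\<in>UNIV. d\<phi> i * Q i c d + \<phi> * dQ i i c d) * g c a * g d b)
     + \<phi> * (\<Sum>i\<in>UNIV. \<Sum>c\<in>UNIV. \<Sum>d\<in>UNIV. Q i c d * g c a * dg i d b)
     + \<phi> * (\<Sum>i\<in>UNIV. \<Sum>c\<in>UNIV. \<Sum>d\<in>UNIV. Q i c d * dg i c a * g d b)"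
  proof -
    have "(\<Sum>c\<in>UNIV. \<Sum>d\<in>UNIV. (\<Sum>i\<in>UNIV. d\<phi> i * Q i c d + \<phi> * dQ i i c d) * g c a * g d b)
       = (\<Sum>i\<in>UNIV. \<Sum>c\<in>UNIV. \<Sum>d\<in>UNIV. (d\<phi> i * Q i c d + \<phi> * dQ i i c d) * g c a * g d b)"
      by (simp only: sum_distrib_right) (subst (2) sum.swap, subst sum.swap, rule refl)
    thus ?thesis
      by (simp add: dT sum_distrib_left sum.distrib[symmetric] algebra_simps)
  qed
  thus ?thesis unfolding sum_subtractf Y X[of b a] by simp
qed

section \<open>The Levi-Civita connection and the volume density\<close>

context hermitian_chart
begin

definition christoffel :: "real^4 \<Rightarrow> 4 \<Rightarrow> 4 \<Rightarrow> 4 \<Rightarrow> real" where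
  "christoffel y a b k = (1/2) * (\<Sum>j\<in>UNIV. matrix_inv (G y) $ k $ j *
     (partial_deriv a (\<lambda>y. G y $ b $ j) y + partial_deriv b (\<lambda>y. G y $ a $ j) y - partial_deriv j (\<lambda>y. G y $ a $ b) y))"

lemma G_sym: "y \<in> U \<Longrightarrow> G y $ b $ a = G y $ a $ b"
  using arg_cong[OF hermitian4.sym[OF hermitian], of y "\<lambda>A. A $ a $ b"] by (simp add: transpose_def)

lemma dG_sym: "y \<in> U \<Longrightarrow> partial_deriv k (\<lambda>y. G y $ b $ a) y = partial_deriv k (\<lambda>y. G y $ a $ b) y"
  by (rule partial_deriv_cong[OF open_U]) (auto intro: G_sym)

lemma christoffel_sym:
  assumes "y \<in> U" shows "christoffel y a b k = christoffel y b a k"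
proof -
  have "partial_deriv a (\<lambda>y. G y $ b $ j) y + partial_deriv b (\<lambda>y. G y $ a $ j) y - partial_deriv j (\<lambda>y. G y $ a $ b) y
    = partial_deriv b (\<lambda>y. G y $ a $ j) y + partial_deriv a (\<lambda>y. G y $ b $ j) y - partial_deriv j (\<lambda>y. G y $ b $ a) y" for j
    using dG_sym[OF assms, of j b a] by simp
  thus ?thesis unfolding christoffel_def by (simp only:)
qed

lemma levi_civita_eq:
  assumes y: "y \<in> U"
  shows "levi_civita G y u v $ k = (\<Sum>a\<in>UNIV. \<Sum>b\<in>UNIV. u$a * v$b * christoffel y a b k)"
proof -
  let ?dG = "\<lambda>a b c. partial_deriv a (\<lambda>y. G y $ b $ c) y"
  note fd = frechet_derivative_bilinear(2)[of G, OF D(1)[OF G_entry y]]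
  have 1: "frechet_derivative (\<lambda>y. gprod (G y) v (axis j 1)) (at y) u = (\<Sum>a\<in>UNIV. \<Sum>b\<in>UNIV. u$a * v$b * ?dG a b j)" for u v j
    unfolding gprod_def fd by (simp add: axis_def if_distrib if_distribR cong: if_cong)
  have 2: "frechet_derivative (\<lambda>y. gprod (G y) v (axis j 1)) (at y) u = (\<Sum>a\<in>UNIV. \<Sum>b\<in>UNIV. u$b * v$a * ?dG b a j)" for u v j
    unfolding 1 by (rule sum.swap)
  have 3: "frechet_derivative (\<lambda>y. gprod (G y) u v) (at y) (axis j 1) = (\<Sum>a\<in>UNIV. \<Sum>b\<in>UNIV. u$a * v$b * ?dG j a b)" for u v j
    unfolding gprod_def inner_matrix_expand partial_deriv_def[THEN fun_cong, symmetric]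
    using D(1)[OF G_entry y] by (simp add: partial_deriv_sum partial_deriv_cmult)
  have "levi_civita G y u v $ k = (1/2) * (\<Sum>j\<in>UNIV. matrix_inv (G y) $ k $ j *
     (\<Sum>a\<in>UNIV. \<Sum>b\<in>UNIV. u$a * v$b * (?dG a b j + ?dG b a j - ?dG j a b)))"
    unfolding levi_civita_def sharp_def 1[of v _ u] 2[of u _ v] 3
    by (simp add: matrix_vector_mult_def sum.distrib[symmetric] sum_subtractf[symmetric] algebra_simps)
  also have "\<dots> = (\<Sum>j\<in>UNIV. \<Sum>a\<in>UNIV. \<Sum>b\<in>UNIV. u$a * v$b * ((1/2) * (matrix_inv (G y) $ k $ j * (?dG a b j + ?dG b a j - ?dG j a b))))"
    by (simp add: sum_distrib_left ac_simps)
  also have "\<dots> = (\<Sum>a\<in>UNIV. \<Sum>b\<in>UNIV. u$a * v$b * christoffel y a b k)"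
    unfolding christoffel_def sum_distrib_left
    by (subst sum.swap, rule sum.cong[OF refl], rule sum.swap)
  finally show ?thesis .
qed

lemma hodge_entry: "twice_differentiable_on U (\<lambda>y. hodge (W y) $ a $ b)"
proof -
  have "\<forall>a b. twice_differentiable_on U (\<lambda>y. hodge (W y) $ a $ b)"
    by (simp add: forall_4 hodge_def W_entry twice_differentiable_on_const twice_differentiable_on_uminus open_U)
  thus ?thesis by blast
qed

lemma pf_twice: "twice_differentiable_on U (\<lambda>y. pf (W y))"
  unfolding pf_def by (intro twice_differentiable_on_add twice_differentiable_on_mult open_U W_entry)

lemma matrix_inv_G_eq:
  assumes "y \<in> U"
  shows "matrix_inv (G y) $ a $ b = - inverse (pf (W y)) * (\<Sum>c\<in>UNIV. hodge (W y) $ a $ c * K y $ b $ c)"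
  using hermitian4.matrix_inv_G[OF hermitian[OF assms]] W_eq[OF assms]
  by (simp add: matrix_matrix_mult_def transpose_def divide_inverse)

text \<open>\<open>matrix_inv\<close> is defined by choice, so the explicit formula
  \<open>matrix_inv_G_eq\<close> on the chart is differentiated instead.\<close>

lemma matrix_inv_G_differentiable:
  assumes "x \<in> U"
  shows "(\<lambda>y. matrix_inv (G y) $ a $ b) differentiable (at x)"
  by (rule differentiable_cong_open[OF open_U assms matrix_inv_G_eq])
    (use assms in \<open>auto intro!: derivative_intros D(1)[OF pf_twice] D(1)[OF hodge_entry] D(1)[OF K_entry] simp: pf_W\<close>)

lemma christoffel_differentiable:
  assumes "x \<in> U"
  shows "(\<lambda>y. christoffel y a b k) differentiable (at x)"
  unfolding christoffel_def
  using assms by (auto intro!: derivative_intros matrix_inv_G_differentiable D(2)[OF G_entry])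

lemma G_matrix_inv_entry:
  assumes "y \<in> U"
  shows "(\<Sum>k\<in>UNIV. G y $ l $ k * matrix_inv (G y) $ k $ j) = (if l = j then 1 else 0)"
    "(\<Sum>k\<in>UNIV. matrix_inv (G y) $ l $ k * G y $ k $ j) = (if l = j then 1 else 0)"
  using hermitian4.matrix_inv_G_mult[OF hermitian[OF assms]]
  by (simp_all add: matrix_matrix_mult_def mat_def vec_eq_iff)

lemma matrix_inv_G_sym:
  assumes "y \<in> U" shows "matrix_inv (G y) $ b $ a = matrix_inv (G y) $ a $ b"
proof -
  interpret h: hermitian4 "G y" "K y" using hermitian assms .
  have "transpose (G y ** matrix_inv (G y)) = mat 1" by (simp only: h.matrix_inv_G_mult transpose_mat)
  hence 1: "transpose (matrix_inv (G y)) ** G y = mat 1" by (simp only: matrix_transpose_mul h.sym)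
  have "transpose (matrix_inv (G y)) = transpose (matrix_inv (G y)) ** G y ** matrix_inv (G y)"
    by (simp only: matrix_mul_assoc[symmetric] h.matrix_inv_G_mult matrix_mul_rid)
  hence "transpose (matrix_inv (G y)) = matrix_inv (G y)" by (simp only: 1 matrix_mul_lid)
  from arg_cong[OF this, of "\<lambda>A. A $ a $ b"] show ?thesis by (simp add: transpose_def)
qed

lemma christoffel_lower:
  assumes y: "y \<in> U"
  shows "(\<Sum>k\<in>UNIV. G y $ l $ k * christoffel y a b k) = (1/2) * (partial_deriv a (\<lambda>y. G y $ b $ l) y
    + partial_deriv b (\<lambda>y. G y $ a $ l) y - partial_deriv l (\<lambda>y. G y $ a $ b) y)"
proof -
  let ?Z = "\<lambda>j. partial_deriv a (\<lambda>y. G y $ b $ j) y + partial_deriv b (\<lambda>y. G y $ a $ j) y - partial_deriv j (\<lambda>y. G y $ a $ b) y"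
  have "(\<Sum>k\<in>UNIV. G y $ l $ k * christoffel y a b k) = (\<Sum>k\<in>UNIV. \<Sum>j\<in>UNIV. (1/2) * ?Z j * (G y $ l $ k * matrix_inv (G y) $ k $ j))"
    unfolding christoffel_def sum_distrib_left by (intro sum.cong refl) simp
  also have "\<dots> = (\<Sum>j\<in>UNIV. (1/2) * ?Z j * (\<Sum>k\<in>UNIV. G y $ l $ k * matrix_inv (G y) $ k $ j))"
    by (subst sum.swap) (simp only: sum_distrib_left)
  also have "\<dots> = (1/2) * ?Z l"
    unfolding G_matrix_inv_entry[OF y]
    by (simp only: mult_delta_right sum.delta' finite_class.finite_UNIV if_True UNIV_I)
  finally show ?thesis .
qed

lemma K_square_trace: "y \<in> U \<Longrightarrow> (\<Sum>k\<in>UNIV. \<Sum>i\<in>UNIV. K y $ k $ i * K y $ i $ k) = - 4"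
  using hermitian4.cplx[OF hermitian, of y] by (simp add: matrix_matrix_mult_def mat_def vec_eq_iff)

text \<open>The derivative of the constant trace of \<open>K ** K\<close>. It removes the
  derivatives of \<open>K\<close> from the derivative of \<open>pf W\<close>, in line with its
  modulus being the volume density of the metric.\<close>

lemma dK_K:
  assumes y: "y \<in> U"
  shows "(\<Sum>k\<in>UNIV. \<Sum>i\<in>UNIV. partial_deriv b (\<lambda>y. K y $ k $ i) y * K y $ i $ k) = 0"
proof -
  let ?dK = "\<lambda>k i. partial_deriv b (\<lambda>y. K y $ k $ i) y"
  note K = D(1)[OF K_entry y]
  have "partial_deriv b (\<lambda>y. \<Sum>k\<in>UNIV. \<Sum>i\<in>UNIV. K y $ k $ i * K y $ i $ k) y = 0"
    using partial_deriv_cong[OF open_U y K_square_trace] by (simp add: partial_deriv_const)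
  hence "(\<Sum>k\<in>UNIV. \<Sum>i\<in>UNIV. ?dK k i * K y $ i $ k) + (\<Sum>k\<in>UNIV. \<Sum>i\<in>UNIV. K y $ k $ i * ?dK i k) = 0"
    by (simp add: partial_deriv_sum partial_deriv_mult K sum.distrib)
  moreover have "(\<Sum>k\<in>UNIV. \<Sum>i\<in>UNIV. K y $ k $ i * ?dK i k) = (\<Sum>k\<in>UNIV. \<Sum>i\<in>UNIV. ?dK k i * K y $ i $ k)"
    by (subst sum.swap) (simp add: mult.commute)
  ultimately show ?thesis by simp
qed

text \<open>Jacobi's formula for the volume density, with the sign of the orientation carried
  along.\<close>

lemma partial_deriv_pf:
  assumes y: "y \<in> U"
  shows "partial_deriv b (\<lambda>y. pf (W y)) y = pf (W y) * (\<Sum>i\<in>UNIV. christoffel y i b i)"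
proof -
  interpret h: hermitian4 "G y" "K y" using hermitian y .
  let ?g = "\<lambda>i j. G y $ i $ j" and ?gi = "\<lambda>i j. matrix_inv (G y) $ i $ j" and ?B = "\<lambda>i j. hodge (W y) $ i $ j"
  let ?dK = "\<lambda>k i. partial_deriv b (\<lambda>y. K y $ k $ i) y" and ?dg = "\<lambda>k i. partial_deriv b (\<lambda>y. G y $ k $ i) y"
  let ?dW = "\<lambda>k i. partial_deriv b (\<lambda>y. W y $ k $ i) y"
  note K = D(1)[OF K_entry y] and G = D(1)[OF G_entry y] and Wd = D(1)[OF W_entry y]
  have dW: "?dW i j = (\<Sum>k\<in>UNIV. ?dK k i * ?g k j) + (\<Sum>k\<in>UNIV. K y $ k $ i * ?dg k j)" for i j
    unfolding W_def matrix_matrix_mult_def transpose_def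
    by (simp add: partial_deriv_sum partial_deriv_mult K G sum.distrib)
  have "?dW i i = 0" for i using dW_skew[OF y, of b i i] by simp
  \<comment> \<open>The differential of the quadratic function \<open>pf\<close> is
    \<open>- 1/2\<close> times the trace of \<open>hodge W ** dW\<close>.\<close>
  hence "partial_deriv b (\<lambda>y. pf (W y)) y = - (1/2) * (\<Sum>j\<in>UNIV. \<Sum>i\<in>UNIV. ?B j i * ?dW i j)"
    unfolding pf_def
    by (simp add: partial_deriv_add partial_deriv_mult Wd sum_4 hodge_def dW_skew[OF y, of b 2 1] dW_skew[OF y, of b 3 1]
      dW_skew[OF y, of b 4 1] dW_skew[OF y, of b 3 2] dW_skew[OF y, of b 4 2] dW_skew[OF y, of b 4 3] skew_entry[OF W_skew[OF y], of 3 1])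
      (simp add: field_simps)
  also have "(\<Sum>j\<in>UNIV. \<Sum>i\<in>UNIV. ?B j i * ?dW i j) =
     (\<Sum>j\<in>UNIV. \<Sum>i\<in>UNIV. \<Sum>k\<in>UNIV. ?dK k i * (?g k j * ?B j i)) + (\<Sum>j\<in>UNIV. \<Sum>i\<in>UNIV. \<Sum>k\<in>UNIV. ?dg k j * (?B j i * K y $ k $ i))"
    unfolding dW by (simp add: distrib_left sum.distrib sum_distrib_left ac_simps)
  \<comment> \<open>The contribution of \<open>dK\<close>: \<open>GS\<close> reduces it to the trace
    of \<open>dK ** K\<close>.\<close>
  also have "(\<Sum>j\<in>UNIV. \<Sum>i\<in>UNIV. \<Sum>k\<in>UNIV. ?dK k i * (?g k j * ?B j i)) = 0"
  proof -
    have GB: "(\<Sum>j\<in>UNIV. ?g k j * ?B j i) = pf (W y) * K y $ i $ k" for k i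
      using h.GS W_eq[OF y] by (simp add: matrix_matrix_mult_def transpose_def vec_eq_iff)
    have "(\<Sum>j\<in>UNIV. \<Sum>i\<in>UNIV. \<Sum>k\<in>UNIV. ?dK k i * (?g k j * ?B j i)) = (\<Sum>i\<in>UNIV. \<Sum>k\<in>UNIV. \<Sum>j\<in>UNIV. ?dK k i * (?g k j * ?B j i))"
      by (subst sum.swap, rule sum.cong[OF refl], rule sum.swap)
    also have "\<dots> = pf (W y) * (\<Sum>k\<in>UNIV. \<Sum>i\<in>UNIV. ?dK k i * K y $ i $ k)"
      by (subst (2) sum.swap) (simp add: sum_distrib_left[symmetric] GB, simp add: sum_distrib_left ac_simps)
    finally show ?thesis by (simp add: dK_K[OF y])
  qed
  \<comment> \<open>The contribution of \<open>dG\<close>: \<open>S ** transpose K\<close> is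
    \<open>- pf W\<close> times the inverse metric.\<close>
  also have "(\<Sum>j\<in>UNIV. \<Sum>i\<in>UNIV. \<Sum>k\<in>UNIV. ?dg k j * (?B j i * K y $ k $ i)) = - pf (W y) * (\<Sum>i\<in>UNIV. \<Sum>j\<in>UNIV. ?gi i j * ?dg i j)"
  proof -
    have "(\<Sum>i\<in>UNIV. ?B j i * K y $ k $ i) = - pf (W y) * ?gi j k" for j k
      using matrix_inv_G_eq[OF y, of j k] pf_W[OF y] by simp
    moreover have "(\<Sum>j\<in>UNIV. \<Sum>i\<in>UNIV. \<Sum>k\<in>UNIV. ?dg k j * (?B j i * K y $ k $ i)) =
        (\<Sum>j\<in>UNIV. \<Sum>k\<in>UNIV. ?dg k j * (\<Sum>i\<in>UNIV. ?B j i * K y $ k $ i))"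
      unfolding sum_distrib_left by (rule sum.cong[OF refl], rule sum.swap)
    ultimately show ?thesis
      by (simp add: sum_distrib_left) (subst sum.swap, simp add: matrix_inv_G_sym[OF y] ac_simps)
  qed
  \<comment> \<open>In the Christoffel trace the two metric derivatives in directions other than
    \<open>b\<close> cancel by symmetry.\<close>
  also have "(\<Sum>i\<in>UNIV. \<Sum>j\<in>UNIV. ?gi i j * ?dg i j) = 2 * (\<Sum>i\<in>UNIV. christoffel y i b i)"
  proof -
    have "(\<Sum>i\<in>UNIV. \<Sum>j\<in>UNIV. ?gi i j * partial_deriv i (\<lambda>y. G y $ b $ j) y) = (\<Sum>i\<in>UNIV. \<Sum>j\<in>UNIV. ?gi i j * partial_deriv j (\<lambda>y. G y $ i $ b) y)"
      by (subst sum.swap) (intro sum.cong refl, metis matrix_inv_G_sym[OF y] dG_sym[OF y])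
    moreover have "2 * (\<Sum>i\<in>UNIV. christoffel y i b i) = (\<Sum>i\<in>UNIV. \<Sum>j\<in>UNIV. ?gi i j * partial_deriv i (\<lambda>y. G y $ b $ j) y)
      + (\<Sum>i\<in>UNIV. \<Sum>j\<in>UNIV. ?gi i j * ?dg i j) - (\<Sum>i\<in>UNIV. \<Sum>j\<in>UNIV. ?gi i j * partial_deriv j (\<lambda>y. G y $ i $ b) y)"
      unfolding christoffel_def
      by (simp add: sum_distrib_left sum.distrib[symmetric] sum_subtractf[symmetric] algebra_simps)
    ultimately show ?thesis by simp
  qed
  finally show ?thesis by simp
qed

text \<open>The trace is the logarithmic derivative of \<open>pf W\<close>, written
  \<open>inverse (pf W) * \<partial>\<^sub>b pf W\<close>, so its derivative is symmetric. This
  supplies hypothesis \<open>dL\<close> of \<open>skew_ricci_algebra\<close>.\<close>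

lemma christoffel_trace_closed:
  assumes x: "x \<in> U"
  shows "(\<Sum>i\<in>UNIV. partial_deriv a (\<lambda>y. christoffel y i b i) x) = (\<Sum>i\<in>UNIV. partial_deriv b (\<lambda>y. christoffel y i a i) x)"
proof -
  let ?r = "\<lambda>y. pf (W y)"
  have d: "(\<Sum>i\<in>UNIV. partial_deriv a (\<lambda>y. christoffel y i b i) x) =
      inverse (?r x) * partial_deriv a (partial_deriv b ?r) x - partial_deriv a ?r x * partial_deriv b ?r x / (?r x)\<^sup>2" for a b
  proof -
    have "(\<Sum>i\<in>UNIV. partial_deriv a (\<lambda>y. christoffel y i b i) x) = partial_deriv a (\<lambda>y. \<Sum>i\<in>UNIV. christoffel y i b i) x"
      by (rule partial_deriv_sum[symmetric]) (rule christoffel_differentiable[OF x])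
    also have "\<dots> = partial_deriv a (\<lambda>y. inverse (?r y) * partial_deriv b ?r y) x"
      by (rule partial_deriv_cong[OF open_U x]) (simp add: partial_deriv_pf pf_W)
    also have "\<dots> = inverse (?r x) * partial_deriv a (partial_deriv b ?r) x - partial_deriv a ?r x * partial_deriv b ?r x / (?r x)\<^sup>2"
      using D[OF pf_twice x] pf_W[OF x] by (subst partial_deriv_mult) (auto simp: partial_deriv_inverse)
    finally show ?thesis .
  qed
  show ?thesis unfolding d
    using twice_differentiable_on_commute[OF open_U pf_twice x, of a b] by (simp add: mult.commute)
qed

end

lemma sum_axis: "(\<Sum>a\<in>UNIV. axis (i::'n::finite) (1::real) $ a * X a) = X i"
  by (simp add: axis_def if_distrib if_distribR cong: if_cong)

section \<open>The contravariant counterpart of the torsion 3-form and its divergence\<close>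

context hermitian_chart
begin

abbreviation \<eta> :: "real^4 \<Rightarrow> real^4" where "\<eta> y \<equiv> transpose (K y) *v lee y"

text \<open>This is \<open>(pf W)\<^sup>2\<close> times
  \<open>(\<theta> \<circ> K) \<and> \<omega>\<close> with all indices raised. Its entries are
  polynomial in \<open>W\<close> and its first partials, so no inverse metric appears in their
  derivatives.\<close>

abbreviation Q :: "real^4 \<Rightarrow> 4 \<Rightarrow> 4 \<Rightarrow> 4 \<Rightarrow> real" where
  "Q y \<equiv> wedge12 (div_hodge y) (hodge (W y))"

lemma div_hodge_differentiable:
  assumes "x \<in> U" shows "(\<lambda>y. div_hodge y $ a) differentiable (at x)"
  unfolding div_hodge_def vec_lambda_beta
  by (intro differentiable_sum ballI D(2)[OF hodge_entry assms]) simp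

lemma Q_differentiable: "x \<in> U \<Longrightarrow> (\<lambda>y. Q y i c d) differentiable (at x)"
  unfolding wedge12_def
  by (intro differentiable_add differentiable_mult div_hodge_differentiable D(1)[OF hodge_entry])

text \<open>Only the last two indices are lowered; the first stays up to match the upper index of
  the torsion.\<close>

lemma Q_lower:
  assumes y: "y \<in> U"
  shows "(\<Sum>c\<in>UNIV. \<Sum>d\<in>UNIV. Q y i c d * G y $ c $ a * G y $ d $ b) =
    pf (W y) * div_hodge y $ i * W y $ a $ b + (pf (W y))\<^sup>2 * (\<eta> y $ a * K y $ i $ b - \<eta> y $ b * K y $ i $ a)"
proof -
  interpret h: hermitian4 "G y" "K y" using hermitian y .
  let ?g = "\<lambda>i j. G y $ i $ j" and ?B = "\<lambda>i j. hodge (W y) $ i $ j" and ?s = "\<lambda>i. div_hodge y $ i" and ?r = "pf (W y)"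
  have f1: "(\<Sum>d\<in>UNIV. ?B c d * ?g d b) = - ?r * K y $ c $ b" for c b
    using h.SG W_eq[OF y] by (simp add: matrix_matrix_mult_def vec_eq_iff)
  have f1': "(\<Sum>d\<in>UNIV. ?B d c * ?g d b) = ?r * K y $ c $ b" for c b
  proof -
    have "(\<Sum>d\<in>UNIV. ?B d c * ?g d b) = - (\<Sum>d\<in>UNIV. ?B c d * ?g d b)"
      unfolding sum_negf[symmetric] by (intro sum.cong refl, subst hodge_entry_skew) simp
    thus ?thesis by (simp add: f1)
  qed
  have f2: "(\<Sum>c\<in>UNIV. ?g c a * K y $ c $ b) = - W y $ a $ b" for a b
    using h.KT(1) G_sym[OF y, of _ a] unfolding W_def
    by (simp add: matrix_matrix_mult_def transpose_def vec_eq_iff)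
  have f3: "(\<Sum>c\<in>UNIV. ?s c * ?g c a) = ?r * \<eta> y $ a" for a
  proof -
    have "G y *v div_hodge y = ?r *\<^sub>R \<eta> y"
      using h.GS W_eq[OF y] hodge_lee[OF y]
      by (metis matrix_vector_mul_assoc scaleR_matrix_vector_assoc)
    hence "(G y *v div_hodge y) $ a = ?r * \<eta> y $ a" by simp
    thus ?thesis using G_sym[OF y, of _ a] by (simp add: matrix_vector_mult_def mult.commute)
  qed
  have "(\<Sum>c\<in>UNIV. \<Sum>d\<in>UNIV. Q y i c d * ?g c a * ?g d b) =
      ?s i * (\<Sum>c\<in>UNIV. ?g c a * (\<Sum>d\<in>UNIV. ?B c d * ?g d b))
      + (\<Sum>c\<in>UNIV. ?s c * ?g c a) * (\<Sum>d\<in>UNIV. ?B d i * ?g d b)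
      + (\<Sum>c\<in>UNIV. ?B i c * ?g c a) * (\<Sum>d\<in>UNIV. ?s d * ?g d b)"
    unfolding wedge12_def sum_product[of "\<lambda>c. ?s c * ?g c a"] sum_product[of "\<lambda>c. ?B i c * ?g c a"]
    by (simp add: sum_distrib_left sum.distrib[symmetric] algebra_simps)
  also have "(\<Sum>c\<in>UNIV. ?g c a * (\<Sum>d\<in>UNIV. ?B c d * ?g d b)) = - ?r * (\<Sum>c\<in>UNIV. ?g c a * K y $ c $ b)"
    unfolding f1 by (simp add: sum_distrib_left ac_simps sum_negf)
  finally show ?thesis unfolding f1 f1' f2 f3
    by (simp add: power2_eq_square algebra_simps del: transpose_matrix_vector)
qed

text \<open>By \<open>hodge_mult\<close>, pairing \<open>hodge W\<close> with \<open>W\<close>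
  contributes 4 times \<open>pf W\<close>, and each of the two mixed terms contributes minus
  \<open>pf W\<close>.\<close>

lemma Q_W:
  assumes y: "y \<in> U"
  shows "(\<Sum>c\<in>UNIV. \<Sum>d\<in>UNIV. Q y i c d * W y $ c $ d) = 2 * pf (W y) * div_hodge y $ i"
proof -
  let ?W = "\<lambda>i j. W y $ i $ j" and ?B = "\<lambda>i j. hodge (W y) $ i $ j" and ?s = "\<lambda>i. div_hodge y $ i" and ?r = "pf (W y)"
  have 1: "(\<Sum>d\<in>UNIV. ?W c d * ?B d i) = (if c = i then - ?r else 0)" for c i
    using hodge_mult[OF W_skew[OF y]] by (simp add: matrix_matrix_mult_def vec_eq_iff mat_def if_distrib cong: if_cong)
  have 2: "(\<Sum>c\<in>UNIV. ?B i c * ?W c d) = (if i = d then - ?r else 0)" for d i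
    using mult_hodge[OF W_skew[OF y]] by (simp add: matrix_matrix_mult_def vec_eq_iff mat_def if_distrib cong: if_cong)
  have 3: "(\<Sum>c\<in>UNIV. \<Sum>d\<in>UNIV. ?B c d * ?W c d) = 4 * ?r"
  proof -
    have "(\<Sum>c\<in>UNIV. \<Sum>d\<in>UNIV. ?B c d * ?W c d) = - (\<Sum>c\<in>UNIV. \<Sum>d\<in>UNIV. ?W c d * ?B d c)"
      unfolding sum_negf[symmetric] by (intro sum.cong refl, subst hodge_entry_skew) simp
    thus ?thesis unfolding 1 by simp
  qed
  have "(\<Sum>c\<in>UNIV. \<Sum>d\<in>UNIV. Q y i c d * ?W c d) = ?s i * (\<Sum>c\<in>UNIV. \<Sum>d\<in>UNIV. ?B c d * ?W c d)
     + (\<Sum>c\<in>UNIV. ?s c * (\<Sum>d\<in>UNIV. ?W c d * ?B d i)) + (\<Sum>c\<in>UNIV. \<Sum>d\<in>UNIV. ?s d * (?B i c * ?W c d))"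
    unfolding wedge12_def
    by (simp add: sum_distrib_left sum.distrib[symmetric] algebra_simps)
  also have "(\<Sum>c\<in>UNIV. \<Sum>d\<in>UNIV. ?s d * (?B i c * ?W c d)) = (\<Sum>d\<in>UNIV. ?s d * (\<Sum>c\<in>UNIV. ?B i c * ?W c d))"
    unfolding sum_distrib_left by (rule sum.swap)
  finally show ?thesis unfolding 1 2 3 by (simp add: if_distrib cong: if_cong)
qed

text \<open>By \<open>hodge_lee\<close> this is a skew form evaluated on the diagonal.\<close>

lemma div_hodge_lee:
  assumes "y \<in> U" shows "div_hodge y \<bullet> lee y = 0"
proof -
  have "lee y \<bullet> (hodge (W y) *v lee y) = - (lee y \<bullet> (hodge (W y) *v lee y))"
    unfolding inner_matrix_expand sum_negf[symmetric]
    by (subst sum.swap) (intro sum.cong refl, subst hodge_entry_skew, simp)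
  thus ?thesis using hodge_lee[OF assms] by (simp add: inner_commute)
qed

text \<open>The dual form of \<open>dd\<omega> = 0\<close>: symmetric second derivatives are
  contracted with a skew matrix.\<close>

lemma divergence_div_hodge:
  assumes x: "x \<in> U"
  shows "(\<Sum>i\<in>UNIV. partial_deriv i (\<lambda>y. div_hodge y $ i) x) = 0"
proof -
  let ?X = "\<Sum>i\<in>UNIV. \<Sum>k\<in>UNIV. partial_deriv i (partial_deriv k (\<lambda>y. hodge (W y) $ i $ k)) x"
  have 1: "(\<Sum>i\<in>UNIV. partial_deriv i (\<lambda>y. div_hodge y $ i) x) = ?X"
    unfolding div_hodge_def using D(2)[OF hodge_entry x] by (simp add: partial_deriv_sum)
  have "?X = (\<Sum>i\<in>UNIV. \<Sum>k\<in>UNIV. partial_deriv i (partial_deriv k (\<lambda>y. hodge (W y) $ k $ i)) x)"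
    by (subst sum.swap) (intro sum.cong refl twice_differentiable_on_commute[OF open_U hodge_entry x])
  also have "\<dots> = (\<Sum>i\<in>UNIV. \<Sum>k\<in>UNIV. - partial_deriv i (partial_deriv k (\<lambda>y. hodge (W y) $ i $ k)) x)"
  proof (intro sum.cong refl)
    fix i k :: 4
    have "partial_deriv i (partial_deriv k (\<lambda>y. hodge (W y) $ k $ i)) x = partial_deriv i (\<lambda>y. - partial_deriv k (\<lambda>y. hodge (W y) $ i $ k) y) x"
      by (rule partial_deriv_cong[OF open_U x], subst hodge_entry_skew) (simp add: partial_deriv_uminus D(1)[OF hodge_entry])
    thus "partial_deriv i (partial_deriv k (\<lambda>y. hodge (W y) $ k $ i)) x = - partial_deriv i (partial_deriv k (\<lambda>y. hodge (W y) $ i $ k)) x"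
      by (simp add: partial_deriv_uminus D(2)[OF hodge_entry x])
  qed
  also have "\<dots> = - ?X" by (simp add: sum_negf)
  finally show ?thesis unfolding 1 by simp
qed

text \<open>The Leibniz rule for the divergence of the contraction in \<open>Q_W\<close>. The term
  with derivatives of \<open>W\<close> vanishes, and so does the divergence of
  \<open>div_hodge\<close>, leaving the derivative of \<open>pf W\<close>.\<close>

lemma divergence_Q_W:
  assumes x: "x \<in> U"
  shows "(\<Sum>c\<in>UNIV. \<Sum>d\<in>UNIV. (\<Sum>i\<in>UNIV. partial_deriv i (\<lambda>y. Q y i c d) x) * W x $ c $ d) =
    2 * (\<Sum>i\<in>UNIV. partial_deriv i (\<lambda>y. pf (W y)) x * div_hodge x $ i)"
proof -
  let ?dQ = "\<lambda>j i c d. partial_deriv j (\<lambda>y. Q y i c d) x" and ?dW = "\<lambda>j c d. partial_deriv j (\<lambda>y. W y $ c $ d) x"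
  note Qd = Q_differentiable[OF x] and Wd = D(1)[OF W_entry x]
  have Qc: "Q x c d i = Q x i c d" for i c d unfolding wedge12_def by simp
  \<comment> \<open>A cyclic \<open>Q\<close> sees only the cyclic sum of these derivatives, which
    is \<open>d\<omega> = \<theta> \<and> \<omega>\<close>; by \<open>Q_W\<close> this becomes
    \<open>div_hodge x \<bullet> lee x\<close>, which is zero.\<close>
  have "3 * (\<Sum>i\<in>UNIV. \<Sum>c\<in>UNIV. \<Sum>d\<in>UNIV. Q x i c d * ?dW i c d) = (\<Sum>i\<in>UNIV. \<Sum>c\<in>UNIV. \<Sum>d\<in>UNIV. Q x i c d * dW x i c d)"
    unfolding dW_def by (rule sum_cyclic[symmetric]) (rule Qc)
  also have "\<dots> = 3 * (\<Sum>i\<in>UNIV. \<Sum>c\<in>UNIV. \<Sum>d\<in>UNIV. Q x i c d * (lee x $ i * W x $ c $ d))"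
    unfolding dW_lee[OF x] unfolding wedge12_def[of "lee x"] by (rule sum_cyclic) (rule Qc)
  also have "(\<Sum>i\<in>UNIV. \<Sum>c\<in>UNIV. \<Sum>d\<in>UNIV. Q x i c d * (lee x $ i * W x $ c $ d)) =
      (\<Sum>i\<in>UNIV. lee x $ i * (\<Sum>c\<in>UNIV. \<Sum>d\<in>UNIV. Q x i c d * W x $ c $ d))"
    by (simp add: sum_distrib_left ac_simps)
  also have "\<dots> = 2 * pf (W x) * (div_hodge x \<bullet> lee x)"
    unfolding Q_W[OF x] by (simp add: inner_vec_def sum_distrib_left ac_simps)
  finally have QdW: "(\<Sum>i\<in>UNIV. \<Sum>c\<in>UNIV. \<Sum>d\<in>UNIV. Q x i c d * ?dW i c d) = 0"
    by (simp add: div_hodge_lee[OF x])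
  have eq: "(\<Sum>c\<in>UNIV. \<Sum>d\<in>UNIV. ?dQ i i c d * W x $ c $ d) + (\<Sum>c\<in>UNIV. \<Sum>d\<in>UNIV. Q x i c d * ?dW i c d)
     = 2 * (partial_deriv i (\<lambda>y. pf (W y)) x * div_hodge x $ i + pf (W x) * partial_deriv i (\<lambda>y. div_hodge y $ i) x)" for i
  proof -
    have "(\<Sum>c\<in>UNIV. \<Sum>d\<in>UNIV. ?dQ i i c d * W x $ c $ d) + (\<Sum>c\<in>UNIV. \<Sum>d\<in>UNIV. Q x i c d * ?dW i c d)
       = partial_deriv i (\<lambda>y. \<Sum>c\<in>UNIV. \<Sum>d\<in>UNIV. Q y i c d * W y $ c $ d) x"
      by (simp add: partial_deriv_sum partial_deriv_mult Qd Wd sum.distrib)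
    also have "\<dots> = partial_deriv i (\<lambda>y. 2 * (pf (W y) * div_hodge y $ i)) x"
      by (rule partial_deriv_cong[OF open_U x]) (simp add: Q_W)
    finally show ?thesis
      by (simp add: partial_deriv_cmult partial_deriv_mult D(1)[OF pf_twice x] div_hodge_differentiable[OF x])
  qed
  have "(\<Sum>i\<in>UNIV. \<Sum>c\<in>UNIV. \<Sum>d\<in>UNIV. ?dQ i i c d * W x $ c $ d) + (\<Sum>i\<in>UNIV. \<Sum>c\<in>UNIV. \<Sum>d\<in>UNIV. Q x i c d * ?dW i c d) =
      (\<Sum>i\<in>UNIV. 2 * (partial_deriv i (\<lambda>y. pf (W y)) x * div_hodge x $ i + pf (W x) * partial_deriv i (\<lambda>y. div_hodge y $ i) x))"
    by (subst sum.distrib[symmetric]) (rule sum.cong[OF refl eq])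
  hence "(\<Sum>i\<in>UNIV. \<Sum>c\<in>UNIV. \<Sum>d\<in>UNIV. ?dQ i i c d * W x $ c $ d) =
     2 * ((\<Sum>i\<in>UNIV. partial_deriv i (\<lambda>y. pf (W y)) x * div_hodge x $ i) + pf (W x) * (\<Sum>i\<in>UNIV. partial_deriv i (\<lambda>y. div_hodge y $ i) x))"
    unfolding QdW by (simp add: sum.distrib sum_distrib_left distrib_left)
  hence "(\<Sum>i\<in>UNIV. \<Sum>c\<in>UNIV. \<Sum>d\<in>UNIV. ?dQ i i c d * W x $ c $ d) =
     2 * (\<Sum>i\<in>UNIV. partial_deriv i (\<lambda>y. pf (W y)) x * div_hodge x $ i)"
    by (simp add: divergence_div_hodge[OF x])
  moreover have "(\<Sum>i\<in>UNIV. \<Sum>c\<in>UNIV. \<Sum>d\<in>UNIV. ?dQ i i c d * W x $ c $ d) =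
     (\<Sum>c\<in>UNIV. \<Sum>d\<in>UNIV. (\<Sum>i\<in>UNIV. ?dQ i i c d) * W x $ c $ d)"
    unfolding sum_distrib_right by (subst sum.swap, rule sum.cong[OF refl], rule sum.swap)
  ultimately show ?thesis by simp
qed

text \<open>Lowering both indices is multiplication by the invertible matrix \<open>G y\<close> on
  either side.\<close>

lemma lower_eq_0:
  assumes y: "y \<in> U" and 0: "\<And>a b. (\<Sum>c\<in>UNIV. \<Sum>d\<in>UNIV. V c d * G y $ c $ a * G y $ d $ b) = 0"
  shows "V c d = 0"
proof -
  interpret h: hermitian4 "G y" "K y" using hermitian y .
  define M where "M = (\<chi> c d. V c d)"
  have "transpose (G y) ** (M ** G y) = 0"
    using 0 by (simp add: vec_eq_iff matrix_matrix_mult_def transpose_def M_def sum_distrib_left ac_simps)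
  hence "G y ** (M ** G y) = 0" by (simp add: h.sym)
  have "M = (matrix_inv (G y) ** G y) ** M ** (G y ** matrix_inv (G y))"
    by (simp add: h.matrix_inv_G_mult)
  also have "\<dots> = matrix_inv (G y) ** (G y ** (M ** G y)) ** matrix_inv (G y)"
    by (simp only: matrix_mul_assoc)
  also have "\<dots> = 0"
    using matrix_scaleR_right[of "matrix_inv (G y)" 0 0] matrix_scaleR_left[of 0 0 "matrix_inv (G y)"]
    by (simp add: \<open>G y ** (M ** G y) = 0\<close>)
  finally have "M = 0" .
  thus ?thesis by (simp add: M_def vec_eq_iff)
qed

section \<open>The connection with torsion \<open>H = \<sigma> d\<^sup>c\<omega>\<close>, where the
  sign \<sigma> covers both complex structures\<close>

context
  fixes H :: "real^4 \<Rightarrow> kform" and \<sigma> :: real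
  assumes H: "\<And>y u v w. y \<in> U \<Longrightarrow> complex_of_real (H y [u, v, w]) = complex_of_real \<sigma> * dc_fund G K y [u, v, w]"
begin

lemma H_expand:
  assumes y: "y \<in> U"
  shows "H y [u, v, w] = (\<Sum>a\<in>UNIV. \<Sum>b\<in>UNIV. \<Sum>c\<in>UNIV. u$a * v$b * w$c * (- \<sigma> * wedge12 (\<eta> y) (W y) a b c))"
proof -
  have "complex_of_real (H y [u, v, w]) = complex_of_real (\<sigma> * (\<Sum>a\<in>UNIV. \<Sum>b\<in>UNIV. \<Sum>c\<in>UNIV. u$a * v$b * w$c * - wedge12 (\<eta> y) (W y) a b c))"
    unfolding H[OF y] dc_fund_axis[OF y] by simp
  thus ?thesis unfolding of_real_eq_iff by (simp add: sum_distrib_left ac_simps del: transpose_matrix_vector)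
qed

lemma H_axis:
  assumes y: "y \<in> U"
  shows "H y [axis a 1, axis b 1, axis c 1] = - \<sigma> * wedge12 (\<eta> y) (W y) a b c"
  unfolding H_expand[OF y] mult.assoc sum_distrib_left[symmetric] sum_axis by simp

definition torsion :: "real^4 \<Rightarrow> 4 \<Rightarrow> 4 \<Rightarrow> 4 \<Rightarrow> real" where
  "torsion y a b k = (1/2) * (\<Sum>j\<in>UNIV. matrix_inv (G y) $ k $ j * H y [axis a 1, axis b 1, axis j 1])"

lemma bismut_plus_eq:
  assumes y: "y \<in> U"
  shows "bismut_plus G H y u v $ k = (\<Sum>a\<in>UNIV. \<Sum>b\<in>UNIV. u$a * v$b * (christoffel y a b k + torsion y a b k))"
proof -
  have H2: "H y [u, v, axis j 1] = (\<Sum>a\<in>UNIV. \<Sum>b\<in>UNIV. u$a * v$b * H y [axis a 1, axis b 1, axis j 1])" for j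
    unfolding H_axis[OF y] unfolding H_expand[OF y] mult.assoc sum_distrib_left[symmetric] sum_axis by simp
  have "bismut_plus G H y u v $ k = levi_civita G y u v $ k + (1/2) * (\<Sum>j\<in>UNIV. matrix_inv (G y) $ k $ j * H y [u, v, axis j 1])"
    by (simp add: bismut_plus_def sharp_def matrix_vector_mult_def)
  also have "(1/2) * (\<Sum>j\<in>UNIV. matrix_inv (G y) $ k $ j * H y [u, v, axis j 1]) =
     (\<Sum>j\<in>UNIV. \<Sum>a\<in>UNIV. \<Sum>b\<in>UNIV. u$a * v$b * ((1/2) * (matrix_inv (G y) $ k $ j * H y [axis a 1, axis b 1, axis j 1])))"
    unfolding H2 by (simp add: sum_distrib_left ac_simps)
  also have "\<dots> = (\<Sum>a\<in>UNIV. \<Sum>b\<in>UNIV. u$a * v$b * torsion y a b k)"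
    unfolding torsion_def sum_distrib_left by (subst sum.swap, rule sum.cong[OF refl], rule sum.swap)
  finally show ?thesis
    unfolding levi_civita_eq[OF y] by (simp add: sum.distrib distrib_left)
qed

lemma torsion_skew: "y \<in> U \<Longrightarrow> torsion y a b k = - torsion y b a k"
  unfolding torsion_def H_axis wedge12_alt(1)[OF W_skew, of _ _ a b] by (simp add: sum_negf)

text \<open>The symmetric inverse metric is contracted with two skew slots of
  \<open>H\<close>.\<close>

lemma torsion_trace:
  assumes y: "y \<in> U" shows "(\<Sum>i\<in>UNIV. torsion y i b i) = 0"
proof -
  let ?t = "\<lambda>i j. matrix_inv (G y) $ i $ j * H y [axis i 1, axis b 1, axis j 1]"
  have "?t j i = - ?t i j" for i j
  proof -
    have "H y [axis j 1, axis b 1, axis i 1] = - H y [axis i 1, axis b 1, axis j 1]"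
      unfolding H_axis[OF y]
      using wedge12_alt[OF W_skew[OF y], of "\<eta> y" b j i] wedge12_alt[OF W_skew[OF y], of "\<eta> y" j b i]
        wedge12_alt[OF W_skew[OF y], of "\<eta> y" b i j] by simp
    thus ?thesis by (simp add: matrix_inv_G_sym[OF y, of j i])
  qed
  hence "(\<Sum>i\<in>UNIV. \<Sum>j\<in>UNIV. ?t i j) = - (\<Sum>i\<in>UNIV. \<Sum>j\<in>UNIV. ?t i j)"
    unfolding sum_negf[symmetric] by (subst sum.swap) (rule sum.cong[OF refl], rule sum.cong[OF refl], blast)
  thus ?thesis by (simp add: torsion_def sum_divide_distrib[symmetric])
qed

text \<open>The sign of \<open>H\<close> and the factor \<open>1/2\<close> of the torsion, divided
  by the \<open>(pf W)\<^sup>2\<close> contained in \<open>Q\<close>.\<close>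

definition \<phi> :: "real^4 \<Rightarrow> real" where
  "\<phi> y = - (\<sigma> / 2) * (inverse (pf (W y)) * inverse (pf (W y)))"

text \<open>Trades the inverse metric in \<open>torsion\<close> for two lowered indices of
  \<open>Q\<close>, the shape that \<open>torsion_divergence_algebra\<close> requires.\<close>

lemma torsion_eq:
  assumes y: "y \<in> U"
  shows "torsion y a b i = \<phi> y * (\<Sum>c\<in>UNIV. \<Sum>d\<in>UNIV. Q y i c d * G y $ c $ a * G y $ d $ b)"
proof -
  interpret h: hermitian4 "G y" "K y" using hermitian y .
  let ?gi = "\<lambda>i j. matrix_inv (G y) $ i $ j"
  have "matrix_inv (G y) ** W y = - K y"
    unfolding W_def h.KT by (simp add: matrix_uminus_right matrix_mul_assoc h.matrix_inv_G_mult)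
  hence h2: "(\<Sum>j\<in>UNIV. ?gi i j * W y $ j $ a) = - K y $ i $ a" for i a
    by (simp add: matrix_matrix_mult_def vec_eq_iff)
  have h1: "(\<Sum>j\<in>UNIV. ?gi i j * W y $ b $ j) = K y $ i $ b" for i b
  proof -
    have "(\<Sum>j\<in>UNIV. ?gi i j * W y $ b $ j) = - (\<Sum>j\<in>UNIV. ?gi i j * W y $ j $ b)"
      unfolding sum_negf[symmetric] by (intro sum.cong refl, subst skew_entry[OF W_skew[OF y]]) simp
    thus ?thesis by (simp add: h2)
  qed
  have h3: "(\<Sum>j\<in>UNIV. ?gi i j * \<eta> y $ j) = div_hodge y $ i / pf (W y)" for i
  proof -
    have "div_hodge y = pf (W y) *\<^sub>R (matrix_inv (G y) *v \<eta> y)"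
      using h.S_eq W_eq[OF y] hodge_lee[OF y] by (metis matrix_vector_mul_assoc scaleR_matrix_vector_assoc)
    hence "div_hodge y $ i = pf (W y) * (matrix_inv (G y) *v \<eta> y) $ i" by simp
    thus ?thesis using pf_W[OF y] by (simp add: matrix_vector_mult_def del: transpose_matrix_vector)
  qed
  have T: "torsion y a b i = - (\<sigma> / 2) * (\<eta> y $ a * (\<Sum>j\<in>UNIV. ?gi i j * W y $ b $ j) + \<eta> y $ b * (\<Sum>j\<in>UNIV. ?gi i j * W y $ j $ a)
      + W y $ a $ b * (\<Sum>j\<in>UNIV. ?gi i j * \<eta> y $ j))"
    unfolding torsion_def H_axis[OF y] wedge12_def
    by (simp add: sum_distrib_left sum.distrib[symmetric] algebra_simps del: transpose_matrix_vector)
  show ?thesis unfolding T h1 h2 h3 Q_lower[OF y] \<phi>_def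
    using pf_W[OF y] by (simp add: field_simps power2_eq_square del: transpose_matrix_vector)
qed

lemma \<phi>_differentiable: "x \<in> U \<Longrightarrow> \<phi> differentiable (at x)"
  unfolding \<phi>_def using D(1)[OF pf_twice] pf_W by (auto intro!: derivative_intros)

text \<open>As \<phi> is a constant times the inverse square of \<open>pf W\<close>, this is
  \<open>partial_deriv_pf\<close> with weight -2.\<close>

lemma partial_deriv_\<phi>:
  assumes x: "x \<in> U"
  shows "partial_deriv j \<phi> x = - 2 * \<phi> x * (\<Sum>i\<in>UNIV. christoffel x i j i)"
proof -
  have 1: "(\<lambda>y. inverse (pf (W y))) differentiable (at x)"
    using D(1)[OF pf_twice x] pf_W[OF x] by (auto intro!: derivative_intros)
  have "partial_deriv j \<phi> x = - (\<sigma> / 2) * (2 * (inverse (pf (W x)) * partial_deriv j (\<lambda>y. inverse (pf (W y))) x))"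
    unfolding \<phi>_def using 1 by (subst partial_deriv_cmult) (auto simp: partial_deriv_mult)
  also have "partial_deriv j (\<lambda>y. inverse (pf (W y))) x = - partial_deriv j (\<lambda>y. pf (W y)) x / (pf (W x))\<^sup>2"
    by (rule partial_deriv_inverse[OF D(1)[OF pf_twice x] pf_W[OF x]])
  finally show ?thesis unfolding partial_deriv_pf[OF x] \<phi>_def
    using pf_W[OF x] by (simp add: field_simps power2_eq_square)
qed

lemma torsion_differentiable:
  assumes x: "x \<in> U" shows "(\<lambda>y. torsion y a b i) differentiable (at x)"
  by (rule differentiable_cong_open[OF open_U x torsion_eq])
    (use x in \<open>auto intro!: differentiable_mult differentiable_sum \<phi>_differentiable Q_differentiable D(1)[OF G_entry]\<close>)

lemma partial_deriv_torsion:
  assumes x: "x \<in> U"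
  shows "partial_deriv j (\<lambda>y. torsion y a b i) x = partial_deriv j \<phi> x * (\<Sum>c\<in>UNIV. \<Sum>d\<in>UNIV. Q x i c d * G x $ c $ a * G x $ d $ b)
    + \<phi> x * (\<Sum>c\<in>UNIV. \<Sum>d\<in>UNIV. partial_deriv j (\<lambda>y. Q y i c d) x * G x $ c $ a * G x $ d $ b
      + Q x i c d * partial_deriv j (\<lambda>y. G y $ c $ a) x * G x $ d $ b + Q x i c d * G x $ c $ a * partial_deriv j (\<lambda>y. G y $ d $ b) x)"
proof -
  note d = \<phi>_differentiable[OF x] Q_differentiable[OF x] D(1)[OF G_entry x]
  have "partial_deriv j (\<lambda>y. torsion y a b i) x = partial_deriv j (\<lambda>y. \<phi> y * (\<Sum>c\<in>UNIV. \<Sum>d\<in>UNIV. Q y i c d * G y $ c $ a * G y $ d $ b)) x"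
    by (rule partial_deriv_cong[OF open_U x torsion_eq])
  thus ?thesis
    using d by (simp add: partial_deriv_mult partial_deriv_sum distrib_right)
qed

lemma ricci_bismut_plus:
  assumes x: "x \<in> U"
  shows "ricci (bismut_plus G H) x (axis a 1) (axis b 1) =
    (\<Sum>i\<in>UNIV. (partial_deriv i (\<lambda>y. christoffel y a b i) x + partial_deriv i (\<lambda>y. torsion y a b i) x)
      - (partial_deriv a (\<lambda>y. christoffel y i b i) x + partial_deriv a (\<lambda>y. torsion y i b i) x)
      + (\<Sum>k\<in>UNIV. (christoffel x a b k + torsion x a b k) * (christoffel x i k i + torsion x i k i))
      - (\<Sum>k\<in>UNIV. (christoffel x i b k + torsion x i b k) * (christoffel x a k i + torsion x a k i)))"
proof -
  let ?C = "\<lambda>y a b k. christoffel y a b k + torsion y a b k"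
  let ?\<Gamma> = "bismut_plus G H"
  have C: "?\<Gamma> y (axis a 1) w $ k = (\<Sum>b\<in>UNIV. w $ b * ?C y a b k)" if "y \<in> U" for y a w k
    unfolding bismut_plus_eq[OF that] mult.assoc sum_distrib_left[symmetric] sum_axis ..
  have C2: "?\<Gamma> y (axis a 1) (axis b 1) $ k = ?C y a b k" if "y \<in> U" for y a b k
    unfolding C[OF that] sum_axis ..
  have diff: "(\<lambda>y. ?C y a b k) differentiable (at x)" for a b k
    by (intro differentiable_add christoffel_differentiable torsion_differentiable x)
  have d: "(\<lambda>y. ?\<Gamma> y (axis a 1) (axis b 1) $ k) differentiable (at x)" for a b k
    by (rule differentiable_cong_open[OF open_U x C2 diff])
  have fd: "frechet_derivative (\<lambda>y. ?\<Gamma> y (axis a 1) (axis b 1)) (at x) (axis j 1) $ k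
      = partial_deriv j (\<lambda>y. christoffel y a b k) x + partial_deriv j (\<lambda>y. torsion y a b k) x" for a b j k
  proof -
    have "frechet_derivative (\<lambda>y. ?\<Gamma> y (axis a 1) (axis b 1)) (at x) (axis j 1) $ k = partial_deriv j (\<lambda>y. ?\<Gamma> y (axis a 1) (axis b 1) $ k) x"
      unfolding partial_deriv_def by (rule frechet_derivative_nth[symmetric], rule differentiable_vec, rule d)
    also have "\<dots> = partial_deriv j (\<lambda>y. ?C y a b k) x" by (rule partial_deriv_cong[OF open_U x C2])
    finally show ?thesis by (simp add: partial_deriv_add christoffel_differentiable torsion_differentiable x)
  qed
  show ?thesis unfolding ricci_def curvature_def
    by (simp add: fd C[OF x] sum_axis)
qed

text \<open>The skew part of the soliton equation is a divergence of the torsion corrected by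
  \<open>df\<close>. In terms of \<open>Q\<close> it says that \<open>V\<close> vanishes, and
  contracting \<open>V\<close> with \<open>W\<close>, the counterpart of wedging with \<omega>,
  leaves the pairing of \<open>df\<close> with \<open>div_hodge\<close>.\<close>

lemma soliton_orthogonal:
  assumes x: "x \<in> U" and h: "twice_differentiable_on U h" and "\<sigma> \<noteq> 0"
    and soliton: "\<And>u v. ricci (bismut_plus G H) x u v + hessian (bismut_plus G H) h x u v = 0"
  shows "(\<chi> i. partial_deriv i h x) \<bullet> (hodge (W x) *v lee x) = 0"
proof -
  let ?N = "christoffel x" and ?T = "torsion x"
  let ?dN = "\<lambda>j a b k. partial_deriv j (\<lambda>y. christoffel y a b k) x" and ?dT = "\<lambda>j a b k. partial_deriv j (\<lambda>y. torsion y a b k) x"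
  let ?f = "\<lambda>k. partial_deriv k h x"
  let ?L = "\<lambda>k. \<Sum>i\<in>UNIV. christoffel x i k i"
  let ?dQ = "\<lambda>j i c d. partial_deriv j (\<lambda>y. Q y i c d) x"
  have hess: "hessian (bismut_plus G H) h x (axis a 1) (axis b 1) = partial_deriv a (partial_deriv b h) x - (\<Sum>k\<in>UNIV. (?N a b k + ?T a b k) * ?f k)" for a b
  proof -
    have "bismut_plus G H x (axis a 1) (axis b 1) $ k = ?N a b k + ?T a b k" for k
      unfolding bismut_plus_eq[OF x] mult.assoc sum_distrib_left[symmetric] sum_axis ..
    thus ?thesis
      unfolding hessian_def frechet_derivative_expand[OF D(1)[OF h x]] by (simp add: partial_deriv_def)
  qed
  have dT: "?dT j a b k = - ?dT j b a k" for j a b k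
  proof -
    have "?dT j a b k = partial_deriv j (\<lambda>y. - torsion y b a k) x"
      by (rule partial_deriv_cong[OF open_U x torsion_skew])
    thus ?thesis by (simp add: partial_deriv_uminus torsion_differentiable[OF x])
  qed
  have dT0: "(\<Sum>i\<in>UNIV. ?dT j i b i) = 0" for j b
  proof -
    have "(\<Sum>i\<in>UNIV. ?dT j i b i) = partial_deriv j (\<lambda>y. \<Sum>i\<in>UNIV. torsion y i b i) x"
      by (rule partial_deriv_sum[symmetric]) (rule torsion_differentiable[OF x])
    also have "\<dots> = partial_deriv j (\<lambda>y. 0) x" by (rule partial_deriv_cong[OF open_U x torsion_trace])
    finally show ?thesis by (simp add: partial_deriv_const)
  qed
  have dN: "?dN j a b k = ?dN j b a k" for j a b k
    by (rule partial_deriv_cong[OF open_U x christoffel_sym])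
  \<comment> \<open>Half the difference of the soliton equations at \<open>(a, b)\<close> and
    \<open>(b, a)\<close>.\<close>
  have A: "(\<Sum>i\<in>UNIV. ?dT i a b i) - (\<Sum>i\<in>UNIV. \<Sum>k\<in>UNIV. ?N i b k * ?T a k i - ?N i a k * ?T b k i)
     + (\<Sum>k\<in>UNIV. ?T a b k * ?L k) - (\<Sum>k\<in>UNIV. ?T a b k * ?f k) = 0" for a b
  proof -
    have "ricci (bismut_plus G H) x (axis a 1) (axis b 1) - ricci (bismut_plus G H) x (axis b 1) (axis a 1) =
       2 * ((\<Sum>i\<in>UNIV. ?dT i a b i) + (\<Sum>k\<in>UNIV. ?T a b k * ?L k)
      - (\<Sum>i\<in>UNIV. \<Sum>k\<in>UNIV. ?N i b k * ?T a k i - ?N i a k * ?T b k i))"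
      unfolding ricci_bismut_plus[OF x]
      by (rule skew_ricci_algebra) (fact christoffel_sym[OF x] dN torsion_skew[OF x] dT torsion_trace[OF x] dT0 christoffel_trace_closed[OF x])+
    moreover have "hessian (bismut_plus G H) h x (axis a 1) (axis b 1) - hessian (bismut_plus G H) h x (axis b 1) (axis a 1) =
       - 2 * (\<Sum>k\<in>UNIV. ?T a b k * ?f k)"
      unfolding hess christoffel_sym[OF x, of b a] torsion_skew[OF x, of b a] twice_differentiable_on_commute[OF open_U h x, of b a]
      by (simp add: sum_distrib_left sum_subtractf[symmetric] algebra_simps sum_negf[symmetric] del: sum_negf)
    moreover have "X - Z + Y - F = 0"
      if "r - r' = 2 * (X + Y - Z)" "s - s' = - 2 * F" "r + s = 0" "r' + s' = 0" for r r' s s' X Y Z F :: real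
      using that by argo
    ultimately show ?thesis using soliton[of "axis a 1" "axis b 1"] soliton[of "axis b 1" "axis a 1"] by blast
  qed
  \<comment> \<open>The derivative of \<phi> contributes \<open>-2 ?L\<close> and the trace term in
    \<open>A\<close> contributes \<open>+ ?L\<close>, so \<open>- ?L\<close> remains beside
    \<open>- ?f\<close>.\<close>
  define V where "V c d = (\<Sum>i\<in>UNIV. \<phi> x * (?dQ i i c d - (?L i + ?f i) * Q x i c d))" for c d
  have "(\<Sum>c\<in>UNIV. \<Sum>d\<in>UNIV. V c d * G x $ c $ a * G x $ d $ b) = 0" for a b
  proof -
    have 1: "(\<Sum>i\<in>UNIV. ?dT i a b i) - (\<Sum>i\<in>UNIV. \<Sum>k\<in>UNIV. ?N i b k * ?T a k i - ?N i a k * ?T b k i) =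
       (\<Sum>c\<in>UNIV. \<Sum>d\<in>UNIV. (\<Sum>i\<in>UNIV. partial_deriv i \<phi> x * Q x i c d + \<phi> x * ?dQ i i c d) * G x $ c $ a * G x $ d $ b)"
    proof (rule torsion_divergence_algebra[where dg = "\<lambda>k a b. partial_deriv k (\<lambda>y. G y $ a $ b) x"
          and dT = ?dT and dQ = ?dQ and T = ?T and N = ?N])
      show "Q x c i d = - Q x i c d" "Q x i d c = - Q x i c d" for i c d
        by (rule wedge12_alt[OF transpose_hodge])+
    qed (fact G_sym[OF x] dG_sym[OF x] christoffel_lower[OF x] torsion_eq[OF x] partial_deriv_torsion[OF x])+
    have 2: "(\<Sum>k\<in>UNIV. ?T a b k * z k) = (\<Sum>c\<in>UNIV. \<Sum>d\<in>UNIV. (\<Sum>i\<in>UNIV. \<phi> x * (z i * Q x i c d)) * G x $ c $ a * G x $ d $ b)" for z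
    proof -
      have "(\<Sum>k\<in>UNIV. ?T a b k * z k) = (\<Sum>i\<in>UNIV. \<Sum>c\<in>UNIV. \<Sum>d\<in>UNIV. \<phi> x * (z i * Q x i c d) * G x $ c $ a * G x $ d $ b)"
        unfolding torsion_eq[OF x] by (simp add: sum_distrib_left sum_distrib_right ac_simps)
      also have "\<dots> = (\<Sum>c\<in>UNIV. \<Sum>d\<in>UNIV. (\<Sum>i\<in>UNIV. \<phi> x * (z i * Q x i c d)) * G x $ c $ a * G x $ d $ b)"
        unfolding sum_distrib_right by (subst sum.swap, rule sum.cong[OF refl], rule sum.swap)
      finally show ?thesis .
    qed
    have "V c d * G x $ c $ a * G x $ d $ b = (\<Sum>i\<in>UNIV. partial_deriv i \<phi> x * Q x i c d + \<phi> x * ?dQ i i c d) * G x $ c $ a * G x $ d $ b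
        + (\<Sum>i\<in>UNIV. \<phi> x * (?L i * Q x i c d)) * G x $ c $ a * G x $ d $ b - (\<Sum>i\<in>UNIV. \<phi> x * (?f i * Q x i c d)) * G x $ c $ a * G x $ d $ b" for c d
      unfolding V_def partial_deriv_\<phi>[OF x] distrib_right[symmetric] left_diff_distrib[symmetric] sum.distrib[symmetric] sum_subtractf[symmetric]
      by (intro arg_cong2[where f = "(*)"] sum.cong refl) (simp add: algebra_simps)
    hence "(\<Sum>c\<in>UNIV. \<Sum>d\<in>UNIV. V c d * G x $ c $ a * G x $ d $ b) = (\<Sum>i\<in>UNIV. ?dT i a b i)
       - (\<Sum>i\<in>UNIV. \<Sum>k\<in>UNIV. ?N i b k * ?T a k i - ?N i a k * ?T b k i)
       + (\<Sum>k\<in>UNIV. ?T a b k * ?L k) - (\<Sum>k\<in>UNIV. ?T a b k * ?f k)"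
      unfolding 1 2 by (simp only: sum.distrib sum_subtractf)
    thus ?thesis unfolding A .
  qed
  hence "V c d = 0" for c d by (rule lower_eq_0[OF x])
  \<comment> \<open>Contraction with \<omega> makes \<open>divergence_Q_W\<close> and
    \<open>Q_W\<close> applicable.\<close>
  hence "(\<Sum>c\<in>UNIV. \<Sum>d\<in>UNIV. V c d * W x $ c $ d) = 0" by simp
  also have "V c d * W x $ c $ d = \<phi> x * ((\<Sum>i\<in>UNIV. ?dQ i i c d) * W x $ c $ d - (\<Sum>i\<in>UNIV. (?L i + ?f i) * (Q x i c d * W x $ c $ d)))" for c d
    unfolding V_def by (simp add: sum_distrib_left sum_distrib_right sum_subtractf algebra_simps)
  hence "(\<Sum>c\<in>UNIV. \<Sum>d\<in>UNIV. V c d * W x $ c $ d) = \<phi> x * ((\<Sum>c\<in>UNIV. \<Sum>d\<in>UNIV. (\<Sum>i\<in>UNIV. ?dQ i i c d) * W x $ c $ d)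
      - (\<Sum>c\<in>UNIV. \<Sum>d\<in>UNIV. \<Sum>i\<in>UNIV. (?L i + ?f i) * (Q x i c d * W x $ c $ d)))"
    by (simp add: sum_distrib_left[symmetric] sum_subtractf)
  also have "(\<Sum>c\<in>UNIV. \<Sum>d\<in>UNIV. \<Sum>i\<in>UNIV. (?L i + ?f i) * (Q x i c d * W x $ c $ d)) =
      (\<Sum>i\<in>UNIV. (?L i + ?f i) * (\<Sum>c\<in>UNIV. \<Sum>d\<in>UNIV. Q x i c d * W x $ c $ d))"
    unfolding sum_distrib_left by (subst (2) sum.swap, subst sum.swap, rule refl)
  finally have "\<phi> x * (2 * (\<Sum>i\<in>UNIV. partial_deriv i (\<lambda>y. pf (W y)) x * div_hodge x $ i) -
      (\<Sum>i\<in>UNIV. (?L i + ?f i) * (2 * pf (W x) * div_hodge x $ i))) = 0"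
    unfolding divergence_Q_W[OF x] Q_W[OF x] by simp
  moreover have "\<phi> x \<noteq> 0" using \<open>\<sigma> \<noteq> 0\<close> pf_W[OF x] by (simp add: \<phi>_def)
  \<comment> \<open>Since the derivative of \<open>pf W\<close> is \<open>pf W\<close> times
    \<open>?L\<close>, the Christoffel traces occur equally on both sides and only \<open>?f\<close>
    survives.\<close>
  ultimately have "2 * (\<Sum>i\<in>UNIV. pf (W x) * ?L i * div_hodge x $ i) = (\<Sum>i\<in>UNIV. (?L i + ?f i) * (2 * pf (W x) * div_hodge x $ i))"
    by (simp add: partial_deriv_pf[OF x])
  hence "2 * pf (W x) * (\<Sum>i\<in>UNIV. ?f i * div_hodge x $ i) = 0"
    by (simp add: sum_distrib_left sum.distrib algebra_simps)
  thus ?thesis using pf_W[OF x] by (simp add: hodge_lee[OF x] inner_vec_def)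
qed

end

end

section \<open>Generalized Kahler-Ricci solitons\<close>

lemma soliton_field_eq:
  "soliton_field G J h x = (1/2) *\<^sub>R (J x *v (matrix_inv (G x) *v lee_form G J x - matrix_inv (G x) *v (\<chi> i. partial_deriv i h x)))"
proof -
  have "(\<chi> i. lee_form G J x \<bullet> axis i 1) = lee_form G J x" by (simp add: vec_eq_iff inner_axis)
  thus ?thesis by (simp add: soliton_field_def sharp_def gradient_def partial_deriv_def)
qed

lemma hermitian_chartI:
  assumes c: "c \<in> A" "is_chart M c" and g: "riemannian_metric A g"
    and J: "integrable_complex_structure A J" "compatible A g J"
  shows "hermitian_chart (chart_image c) (g c) (J c)"
proof (rule hermitian_chart.intro)
  show U: "open (chart_image c)" using c(2) by (simp add: is_chart_def)
  show "twice_differentiable_on (chart_image c) (\<lambda>y. g c y $ a $ b)" for a b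
    by (rule smooth_map_on_entry[OF U]) (use c g in \<open>auto simp: riemannian_metric_def smooth_bilinear_field_def\<close>)
  show "twice_differentiable_on (chart_image c) (\<lambda>y. J c y $ a $ b)" for a b
    by (rule smooth_map_on_entry[OF U])
      (use c J in \<open>auto simp: integrable_complex_structure_def smooth_endomorphism_field_def\<close>)
  show "hermitian4 (g c y) (J c y)" if "y \<in> chart_image c" for y
    by unfold_locales (use c g J that in \<open>auto simp: riemannian_metric_def integrable_complex_structure_def compatible_def\<close>)
qed

theorem proposition2p9:
  fixes M :: "'a topology"
    and A :: "'a chart set"
    and g I J :: "'a chart \<Rightarrow> real^4 \<Rightarrow> real^4^4"
    and H :: "'a chart \<Rightarrow> real^4 \<Rightarrow> kform"
    and f :: "'a \<Rightarrow> real"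
  assumes "smooth_4_manifold M A"
    and "generalized_kahler A g I J H"
    and "soliton_potential A g H f"
  shows "\<forall>c\<in>A. \<forall>x\<in>chart_image c.
     (invertible (I c x + J c x) \<longrightarrow>
        F_form (g c x) (I c x + J c x)
          (soliton_field (g c) (I c) (f \<circ> chart_inv c) x)
          (soliton_field (g c) (J c) (f \<circ> chart_inv c) x) = 0) \<and>
     (invertible (I c x - J c x) \<longrightarrow>
        F_form (g c x) (I c x - J c x)
          (soliton_field (g c) (I c) (f \<circ> chart_inv c) x)
          (soliton_field (g c) (J c) (f \<circ> chart_inv c) x) = 0)"
proof (intro ballI)
  fix c x assume c: "c \<in> A" and x: "x \<in> chart_image c"
  let ?h = "f \<circ> chart_inv c"
  have chart: "is_chart M c" using assms(1) c by (simp add: smooth_4_manifold_def)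
  interpret I: hermitian_chart "chart_image c" "g c" "I c"
    using assms(2) by (intro hermitian_chartI[OF c chart]) (auto simp: generalized_kahler_def)
  interpret J: hermitian_chart "chart_image c" "g c" "J c"
    using assms(2) by (intro hermitian_chartI[OF c chart]) (auto simp: generalized_kahler_def)
  have H: "dc_fund (g c) (I c) y [u, v, w] = complex_of_real (H c y [u, v, w])"
    "complex_of_real (H c y [u, v, w]) = - dc_fund (g c) (J c) y [u, v, w]"
    if "y \<in> chart_image c" for y u v w
    using assms(2) c that by (auto simp: generalized_kahler_def)
  \<comment> \<open>The sign \<sigma> is 1 for \<open>I\<close> and -1 for \<open>J\<close>; with
    the same \<open>H\<close> in both cases, one soliton equation serves both structures.\<close>
  have HI: "complex_of_real (H c y [u, v, w]) = complex_of_real 1 * dc_fund (g c) (I c) y [u, v, w]"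
    and HJ: "complex_of_real (H c y [u, v, w]) = complex_of_real (-1) * dc_fund (g c) (J c) y [u, v, w]"
    if "y \<in> chart_image c" for y u v w
    using H[OF that] by simp_all
  have h: "twice_differentiable_on (chart_image c) ?h"
    using assms(3) c by (intro smooth_map_on_real) (simp add: soliton_potential_def smooth_function_def)
  have soliton: "ricci (bismut_plus (g c) (H c)) x u v + hessian (bismut_plus (g c) (H c)) ?h x u v = 0" for u v
    using assms(3) c x by (simp add: soliton_potential_def)
  let ?d = "\<chi> i. partial_deriv i ?h x"
  note hI = I.hermitian[OF x] and hJ = J.hermitian[OF x]
  have oI: "?d \<bullet> (hodge (hermitian4.W (g c x) (I c x)) *v lee_form (g c) (I c) x) = 0"
    unfolding I.W_eq[OF x] I.lee_form_eq[OF x] by (rule I.soliton_orthogonal[OF HI x h _ soliton]) simp_all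
  have oJ: "?d \<bullet> (hodge (hermitian4.W (g c x) (J c x)) *v lee_form (g c) (J c) x) = 0"
    unfolding J.W_eq[OF x] J.lee_form_eq[OF x] by (rule J.soliton_orthogonal[OF HJ x h _ soliton]) simp_all
  \<comment> \<open>Both 3-forms are expressed through the common \<open>H\<close> by
    \<open>H_axis\<close>, with opposite \<sigma>.\<close>
  have w: "wedge12 (transpose (I c x) *v lee_form (g c) (I c) x) (hermitian4.W (g c x) (I c x)) i j k =
      - wedge12 (transpose (J c x) *v lee_form (g c) (J c) x) (hermitian4.W (g c x) (J c x)) i j k" for i j k
    using I.H_axis[OF HI x, of i j k] J.H_axis[OF HJ x, of i j k]
    unfolding I.W_eq[OF x] J.W_eq[OF x] I.lee_form_eq[OF x] J.lee_form_eq[OF x] by simp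
  show "(invertible (I c x + J c x) \<longrightarrow>
        F_form (g c x) (I c x + J c x) (soliton_field (g c) (I c) ?h x) (soliton_field (g c) (J c) ?h x) = 0) \<and>
     (invertible (I c x - J c x) \<longrightarrow>
        F_form (g c x) (I c x - J c x) (soliton_field (g c) (I c) ?h x) (soliton_field (g c) (J c) ?h x) = 0)"
    unfolding soliton_field_eq
    using F_form_eq_0[OF hI hJ _ w oI oJ] F_form_minus_eq_0[OF hI hJ _ w oI oJ] by blast
qed

end
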